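(* Let $s\ge 1$ and let $n,n_1,\dots,n_s$ be integers with $0<n_1<n_2<\cdots<n_s<n$. Let $$S(x_1,x_2,y)=y^{n_1}h_{n-n_1}(x_1,x_2)+\cdots+y^{n_s}h_{n-n_s}(x_1,x_2),$$ where each $h_m(x_1,x_2)$ is a homogeneous polynomial of degree $m$ in $(x_1,x_2)$ with real coefficients, and suppose that both $h_{n-n_1}$ and $h_{n-n_s}$ are non-degenerate. Put $\delta=\max\left(\frac n3,\frac{n-n_s}{2},n_1\right)$. Let $\Phi\in C_0^\infty(\mathbb{R}^3)$ and, for $\lambda>0$, let $$T_\lambda f(y)=\int_{\mathbb{R}^2}e^{i\lambda S(x_1,x_2,y)}\,\Phi(x_1,x_2,y)\,f(x_1,x_2)\,dx_1\,dx_2 .$$ If $\Phi(0,0,0)\neq 0$, then there is a constant $C>0$, independent of $\lambda$, such that for all sufficiently large $\lambda$ $$\|T_\lambda\|_{L^2(\mathbb{R}^2)\to L^2(\mathbb{R})}\ge C\lambda^{-1/(2\delta)} ;$$ thus the decay rate $1/(2\delta)$ is optimal (the exponent $1/(2\delta)$ cannot be replaced by a larger one in an upper bound for $\|T_\lambda\|$). Further, $\delta$ is the modified Newton distance of the phase function $S(x_1,x_2,y)$.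
   Context: A homogeneous polynomial $h(x_1,x_2)$ is called non-degenerate if it is nonzero and has no multiple factors when it is factored into linear terms over the complex numbers, i.e. no two of its linear factors are proportional (in particular a nonzero polynomial of degree one is non-degenerate). $C_0^\infty(\mathbb{R}^3)$ denotes smooth compactly supported functions. For a nonzero polynomial $P(x_1,x_2,y)=\sum_{\alpha\in\mathbb{Z}_{\ge0}^3}c_\alpha x_1^{\alpha_1}x_2^{\alpha_2}y^{\alpha_3}$, its Newton polyhedron is the convex hull of $\bigcup_{c_\alpha\ne0}\left(\alpha+[0,\infty)^3\right)$ in $\mathbb{R}^3$, and its Newton distance is the smallest $t\ge 0$ such that $(t,t,t)$ lies in the Newton polyhedron. The modified Newton distance of $S$ is the maximum of the Newton distances of the polynomials $S(A(x_1,x_2),y)$ over all invertible affine transformations $A$ of $\mathbb{R}^2$ acting on $(x_1,x_2)$. *)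

theory Defs
  imports "HOL-Analysis.Analysis" "HOL-Library.Poly_Mapping"
begin

text \<open>
  Polynomials in the variables indexed by \<open>'n\<close>, as finitely supported maps from exponent
  vectors to coefficients. Multiplication is the convolution product of \<open>Poly_Mapping\<close>.
\<close>

type_synonym ('a, 'n) mvpoly = "(nat ^ 'n) \<Rightarrow>\<^sub>0 'a"

definition Const :: "'a \<Rightarrow> ('a::zero, 'n::finite) mvpoly" where
  "Const c = Poly_Mapping.single 0 c"

definition Var :: "'n \<Rightarrow> ('a::zero_neq_one, 'n::finite) mvpoly" where
  "Var i = Poly_Mapping.single (axis i 1) 1"

text \<open>
  Evaluation at a point of a commutative semiring into which the coefficients are mapped
  by \<open>\<phi>\<close>. With \<open>\<phi> = Const\<close> this is substitution of polynomials for the variables.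
\<close>

definition eval_mvpoly ::
  "('a::zero \<Rightarrow> 'b::comm_semiring_1) \<Rightarrow> ('a, 'n::finite) mvpoly \<Rightarrow> 'b ^ 'n \<Rightarrow> 'b" where
  "eval_mvpoly \<phi> p x =
     (\<Sum>\<alpha>\<in>Poly_Mapping.keys p. \<phi> (Poly_Mapping.lookup p \<alpha>) * (\<Prod>i\<in>UNIV. (x $ i) ^ (\<alpha> $ i)))"

text \<open>The zero polynomial is homogeneous of every degree.\<close>

definition homogeneous :: "nat \<Rightarrow> ('a::zero, 'n::finite) mvpoly \<Rightarrow> bool" where
  "homogeneous m p \<longleftrightarrow> (\<forall>\<alpha>\<in>Poly_Mapping.keys p. (\<Sum>i\<in>UNIV. \<alpha> $ i) = m)"

text \<open>
  A homogeneous form in two variables has an essentially unique factorization into complex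
  linear forms, so it does not matter which one is tested for proportional factors.
\<close>

definition nondegenerate :: "(real, 2) mvpoly \<Rightarrow> bool" where
  "nondegenerate h \<longleftrightarrow> h \<noteq> 0 \<and>
     (\<exists>(c::complex) (ls :: (complex, 2) mvpoly list).
        Poly_Mapping.map complex_of_real h = Const c * prod_list ls \<and>
        (\<forall>l\<in>set ls. l \<noteq> 0 \<and> homogeneous 1 l) \<and>
        (\<forall>i<length ls. \<forall>j<length ls. i \<noteq> j \<longrightarrow> \<not> (\<exists>t. ls ! i = Const t * ls ! j)))"

definition newton_polyhedron :: "('a::zero, 'n::finite) mvpoly \<Rightarrow> (real ^ 'n) set" where
  "newton_polyhedron p =
     convex hull (\<Union>\<alpha>\<in>Poly_Mapping.keys p. {v. \<forall>i. real (\<alpha> $ i) \<le> v $ i})"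

definition newton_distance :: "('a::zero, 'n::finite) mvpoly \<Rightarrow> real" where
  "newton_distance p = (LEAST t. 0 \<le> t \<and> (\<chi> i. t) \<in> newton_polyhedron p)"

text \<open>
  Variables \<open>1\<close>, \<open>2\<close>, \<open>3\<close> stand for \<open>x\<^sub>1\<close>, \<open>x\<^sub>2\<close>, \<open>y\<close>; the affine map \<open>x \<mapsto> A x + b\<close> acts on
  the first two only.
\<close>

definition affine_subst :: "real ^ 2 ^ 2 \<Rightarrow> real ^ 2 \<Rightarrow> (real, 3) mvpoly \<Rightarrow> (real, 3) mvpoly" where
  "affine_subst A b p = eval_mvpoly Const p (vector
     [Const (A $ 1 $ 1) * Var 1 + Const (A $ 1 $ 2) * Var 2 + Const (b $ 1),
      Const (A $ 2 $ 1) * Var 1 + Const (A $ 2 $ 2) * Var 2 + Const (b $ 2),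
      Var 3])"

text \<open>Stated as a relation, so that the maximum is asserted to be attained.\<close>

definition is_modified_newton_distance :: "(real, 3) mvpoly \<Rightarrow> real \<Rightarrow> bool" where
  "is_modified_newton_distance p d \<longleftrightarrow>
     (\<exists>A b. invertible A \<and> newton_distance (affine_subst A b p) = d) \<and>
     (\<forall>A b. invertible A \<longrightarrow> newton_distance (affine_subst A b p) \<le> d)"

fun C_k :: "nat \<Rightarrow> ('a::real_normed_vector \<Rightarrow> 'b::real_normed_vector) \<Rightarrow> bool" where
  "C_k 0 f \<longleftrightarrow> continuous_on UNIV f"
| "C_k (Suc k) f \<longleftrightarrow>
     (\<forall>x. f differentiable (at x)) \<and> (\<forall>v. C_k k (\<lambda>x. frechet_derivative f (at x) v))"

definition smooth_compactly_supported ::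
  "('a::real_normed_vector \<Rightarrow> 'b::real_normed_vector) \<Rightarrow> bool" where
  "smooth_compactly_supported f \<longleftrightarrow> (\<forall>k. C_k k f) \<and> compact (closure {x. f x \<noteq> 0})"

definition L2_norm :: "('a::euclidean_space \<Rightarrow> complex) \<Rightarrow> ennreal" where
  "L2_norm f = (let I = \<integral>\<^sup>+ x. ennreal ((cmod (f x))\<^sup>2) \<partial>lborel
                in if I = \<infinity> then \<infinity> else ennreal (sqrt (enn2real I)))"

text \<open>Extended-valued, so that the supremum exists without a boundedness side condition.\<close>

definition L2_operator_norm ::
  "(('a::euclidean_space \<Rightarrow> complex) \<Rightarrow> ('b::euclidean_space \<Rightarrow> complex)) \<Rightarrow> ennreal" where
  "L2_operator_norm T = (SUP f \<in> {f \<in> borel_measurable lborel. L2_norm f \<le> 1}. L2_norm (T f))"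

definition osc_operator ::
  "(real, 3) mvpoly \<Rightarrow> (real ^ 3 \<Rightarrow> complex) \<Rightarrow> real \<Rightarrow> (real ^ 2 \<Rightarrow> complex) \<Rightarrow> real \<Rightarrow> complex" where
  "osc_operator S \<Phi> lam f y =
     (LINT x|lborel. exp (\<i> * of_real (lam * eval_mvpoly (\<lambda>c. c) S (vector [x $ 1, x $ 2, y])))
        * \<Phi> (vector [x $ 1, x $ 2, y]) * f x)"

end

theory Submission
  imports Defs "HOL-Computational_Algebra.Polynomial"
begin

text \<open>
  Operator norm: test \<open>T\<^sub>\<lambda>\<close> on the indicator of a box on which \<open>\<lambda>S\<close> is small, so that there is
  no cancellation. A box with \<open>x\<close>-sides of order \<open>\<lambda> powr (-p)\<close> and \<open>y\<close>-side of order
  \<open>\<lambda> powr (-q)\<close> gives the bound \<open>\<lambda> powr (- p - q / 2)\<close>, and it is admissible if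
  \<open>p (n - n\<^sub>j) + q n\<^sub>j \<ge> 1\<close> for all \<open>j\<close>. According to the term that attains the maximum \<open>\<delta>\<close>,
  one takes \<open>p = q = 1/n\<close>, or \<open>p = 1/(n - n\<^sub>s)\<close> and \<open>q = 0\<close>, or \<open>p = 0\<close> and \<open>q = 1/n\<^sub>1\<close>.

  Newton distance: the same three weights on the exponents of \<open>S\<close> itself show that its Newton
  distance is at least \<open>\<delta>\<close>. After any affine change of \<open>x\<close>, the part of top degree \<open>n\<close> still
  contains the transformed forms. Since a non-degenerate form has no double zero in the direction
  of a coordinate axis, each of the layers \<open>y ^ n\<^sub>1\<close> and \<open>y ^ n\<^sub>s\<close> contains monomials whose exponent
  in \<open>x\<^sub>1\<close>, respectively \<open>x\<^sub>2\<close>, is at most one. Convex combinations of these reach \<open>(\<delta>, \<delta>, \<delta>)\<close>.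
\<close>

subsection \<open>Evaluation and substitution of polynomials\<close>

text \<open>Additive statements, such as multiplicativity of evaluation in one factor, reduce to
  monomials. A polynomial is built up by adding one monomial with a fresh exponent at a
  time.\<close>

lemma poly_mapping_add_induct [case_names single add]:
  fixes p :: "'k \<Rightarrow>\<^sub>0 'a::comm_monoid_add"
  assumes single: "\<And>k c. P (Poly_Mapping.single k c)"
    and add: "\<And>p q. P p \<Longrightarrow> P q \<Longrightarrow> P (p + q)"
  shows "P p"
proof (induction p rule: update_induct)
  case const
  show ?case using single[of undefined 0] by simp
next
  case (update f a b)
  have "Poly_Mapping.update a b f = f + Poly_Mapping.single a b"
    using update(1)
    by (intro poly_mapping_eqI)
       (auto simp: lookup_update lookup_add lookup_single when_def in_keys_iff)
  then show ?case using add[OF update(3) single] by simp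
qed

text \<open>Cancellation can make the keys of a sum smaller than the union of the keys, so
  evaluations are compared over a common finite index set.\<close>

lemma eval_mvpoly_superset:
  assumes "finite K" "Poly_Mapping.keys p \<subseteq> K" "\<phi> 0 = 0"
  shows "eval_mvpoly \<phi> p x =
    (\<Sum>\<alpha>\<in>K. \<phi> (Poly_Mapping.lookup p \<alpha>) * (\<Prod>i\<in>UNIV. (x $ i) ^ (\<alpha> $ i)))"
  unfolding eval_mvpoly_def using assms
  by (intro sum.mono_neutral_left) (auto simp: in_keys_iff)

lemma eval_mvpoly_zero [simp]: "eval_mvpoly \<phi> 0 x = 0"
  by (simp add: eval_mvpoly_def)

lemma eval_mvpoly_single:
  assumes "\<phi> 0 = 0"
  shows "eval_mvpoly \<phi> (Poly_Mapping.single \<alpha> c) x = \<phi> c * (\<Prod>i\<in>UNIV. (x $ i) ^ (\<alpha> $ i))"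
  by (subst eval_mvpoly_superset[of "{\<alpha>}"]) (use assms in auto)

text \<open>A homomorphism of coefficients makes evaluation a homomorphism. It is instantiated with
  the identity of the reals, for the phase, and of the complex numbers, for the linear
  factors.\<close>

locale coeff_hom =
  fixes \<phi> :: "'a::comm_semiring_1 \<Rightarrow> 'b::comm_semiring_1"
  assumes hom_0: "\<phi> 0 = 0" and hom_1: "\<phi> 1 = 1"
    and hom_add: "\<phi> (a + b) = \<phi> a + \<phi> b" and hom_mult: "\<phi> (a * b) = \<phi> a * \<phi> b"
begin

lemma eval_add: "eval_mvpoly \<phi> (p + q) x = eval_mvpoly \<phi> p x + eval_mvpoly \<phi> q x"
proof -
  let ?K = "Poly_Mapping.keys p \<union> Poly_Mapping.keys q"
  have *: "Poly_Mapping.keys (p + q) \<subseteq> ?K" by (rule keys_add)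
  show ?thesis
    using eval_mvpoly_superset[of ?K p \<phi>] eval_mvpoly_superset[of ?K q \<phi>]
      eval_mvpoly_superset[of ?K "p + q" \<phi>] * hom_0
    by (simp add: lookup_add hom_add distrib_right sum.distrib)
qed

lemma eval_mult: "eval_mvpoly \<phi> (p * q) x = eval_mvpoly \<phi> p x * eval_mvpoly \<phi> q x"
proof (induction p rule: poly_mapping_add_induct)
  case (single k c)
  show ?case
  proof (induction q rule: poly_mapping_add_induct)
    case (single l d)
    show ?case
      by (simp add: mult_single eval_mvpoly_single hom_0 hom_mult power_add prod.distrib mult_ac)
  next
    case (add q r)
    then show ?case by (simp add: distrib_left eval_add)
  qed
next
  case (add p r)
  then show ?case by (simp add: distrib_right eval_add)
qed

lemma eval_Const: "eval_mvpoly \<phi> (Const c) x = \<phi> c"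
  by (simp add: Const_def eval_mvpoly_single hom_0)

lemma eval_one: "eval_mvpoly \<phi> 1 x = 1"
  using eval_Const[of 1 x] by (simp add: Const_def hom_1)

lemma eval_Var: "eval_mvpoly \<phi> (Var j) x = x $ j"
proof -
  have "(\<Prod>i\<in>UNIV. (x $ i) ^ (axis j 1 $ i)) = (\<Prod>i\<in>UNIV. if i = j then x $ i else 1)"
    by (intro prod.cong) (auto simp: axis_def)
  then show ?thesis by (simp add: Var_def eval_mvpoly_single hom_0 hom_1)
qed

lemma eval_sum: "eval_mvpoly \<phi> (\<Sum>i\<in>I. p i) x = (\<Sum>i\<in>I. eval_mvpoly \<phi> (p i) x)"
  by (induction I rule: infinite_finite_induct) (auto simp: eval_add)

lemma eval_prod: "eval_mvpoly \<phi> (\<Prod>i\<in>I. p i) x = (\<Prod>i\<in>I. eval_mvpoly \<phi> (p i) x)"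
  by (induction I rule: infinite_finite_induct) (auto simp: eval_mult eval_one)

lemma eval_power: "eval_mvpoly \<phi> (p ^ k) x = eval_mvpoly \<phi> p x ^ k"
  by (induction k) (auto simp: eval_mult eval_one)

lemma eval_subst:
  fixes p :: "('a, 'm::finite) mvpoly"
  shows "eval_mvpoly \<phi> (eval_mvpoly Const p v) x = eval_mvpoly \<phi> p (\<chi> i. eval_mvpoly \<phi> (v $ i) x)"
  unfolding eval_mvpoly_def[of Const] eval_mvpoly_def[of \<phi> p]
  by (simp add: eval_sum eval_mult eval_prod eval_power eval_Const)

end

interpretation real_eval: coeff_hom "\<lambda>c::real. c"
  by standard auto

interpretation complex_eval: coeff_hom "\<lambda>c::complex. c"
  by standard auto

lemma prod_Var_power:
  "(\<Prod>i\<in>UNIV. (Var i :: ('a::comm_semiring_1, 'n::finite) mvpoly) ^ (\<alpha> $ i)) = Poly_Mapping.single \<alpha> 1"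
proof -
  have pow: "Poly_Mapping.single \<beta> (1::'a) ^ k = Poly_Mapping.single (\<chi> i. k * \<beta> $ i) 1"
    for \<beta> :: "nat ^ 'n" and k
    by (induction k)
       (auto simp: mult_single single_one[symmetric] zero_vec_def plus_vec_def simp del: single_one)
  have pr: "(\<Prod>i\<in>I. Poly_Mapping.single (f i) (1::'a)) = Poly_Mapping.single (\<Sum>i\<in>I. f i) 1"
    if "finite I" for f :: "'n \<Rightarrow> nat ^ 'n" and I
    using that by (induction I) (auto simp: mult_single)
  have "(\<Sum>i\<in>UNIV. (\<chi> j. \<alpha> $ i * axis i 1 $ j)) = \<alpha>"
    by (auto simp: vec_eq_iff axis_def if_distrib cong: if_cong)
  then show ?thesis by (simp add: Var_def pow pr)
qed

lemma eval_Const_Var: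
  fixes p :: "('a::comm_semiring_1, 'n::finite) mvpoly"
  shows "eval_mvpoly Const p (\<chi> i. Var i) = p"
proof -
  have "eval_mvpoly Const p (\<chi> i. Var i) =
    (\<Sum>\<alpha>\<in>Poly_Mapping.keys p. Poly_Mapping.single \<alpha> (Poly_Mapping.lookup p \<alpha>))"
    by (simp add: eval_mvpoly_def prod_Var_power Const_def mult_single)
  also have "\<dots> = p"
    by (intro poly_mapping_eqI) (auto simp: lookup_sum lookup_single when_def in_keys_iff)
  finally show ?thesis .
qed

section \<open>Affine substitutions and the monomials of one layer\<close>

lemma prod_3: "prod f (UNIV :: 3 set) = f 1 * f 2 * f 3"
  unfolding UNIV_3 by (simp add: mult.assoc)

lemma vec_2_eta: "(\<chi> i. f i) = vector [f 1, f (2::2)]" for f :: "2 \<Rightarrow> 'a::zero"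
  by (simp add: vec_eq_iff forall_2)

lemma vec_3_eta: "(\<chi> i. f i) = vector [f 1, f 2, f (3::3)]" for f :: "3 \<Rightarrow> 'a::zero"
  by (simp add: vec_eq_iff forall_3)

text \<open>Serves to show that the maximum in the modified Newton distance is attained in the given
  coordinates.\<close>

lemma affine_subst_id: "affine_subst (mat 1) 0 p = p"
proof -
  have "Const 0 = (0 :: (real, 3) mvpoly)" "Const 1 = (1 :: (real, 3) mvpoly)" by (auto simp: Const_def)
  then show ?thesis
    using eval_Const_Var[of p] by (simp add: affine_subst_def mat_def vec_3_eta)
qed

lemma eval_affine_subst:
  "eval_mvpoly (\<lambda>c. c) (affine_subst A b p) (vector [x $ 1, x $ 2, y]) =
   eval_mvpoly (\<lambda>c. c) p (vector [(A *v x + b) $ 1, (A *v x + b) $ 2, y])"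
  unfolding affine_subst_def real_eval.eval_subst
  by (simp add: vec_3_eta real_eval.eval_add real_eval.eval_mult real_eval.eval_Const
      real_eval.eval_Var matrix_vector_mult_def sum_2)

lemma Var3_power_times_subst:
  fixes h :: "(real, 2) mvpoly"
  shows "(Var 3 :: (real, 3) mvpoly) ^ k * eval_mvpoly Const h (vector [Var 1, Var 2]) =
    (\<Sum>\<beta>\<in>Poly_Mapping.keys h.
       Poly_Mapping.single (vector [\<beta> $ 1, \<beta> $ 2, k]) (Poly_Mapping.lookup h \<beta>))"
proof -
  have *: "(Var 3 :: (real, 3) mvpoly) ^ k * (Const c * (Var 1 ^ a * Var 2 ^ b)) =
    Poly_Mapping.single (vector [a, b, k]) c" for a b c
  proof -
    have "(\<Prod>i\<in>UNIV. (Var i :: (real, 3) mvpoly) ^ ((vector [a, b, k] :: nat ^ 3) $ i)) =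
        Var 1 ^ a * Var 2 ^ b * Var 3 ^ k"
      unfolding prod_3 by simp
    then have "(Var 1 ^ a * Var 2 ^ b * Var 3 ^ k :: (real, 3) mvpoly) =
        Poly_Mapping.single (vector [a, b, k]) 1"
      by (simp only: prod_Var_power)
    moreover have "(Var 3 :: (real, 3) mvpoly) ^ k * (Const c * (Var 1 ^ a * Var 2 ^ b)) =
        Const c * (Var 1 ^ a * Var 2 ^ b * Var 3 ^ k)"
      by (simp only: mult_ac)
    ultimately show ?thesis by (simp add: Const_def mult_single)
  qed
  show ?thesis
    by (simp add: eval_mvpoly_def UNIV_2 sum_distrib_left *)
qed

subsection \<open>Non-degenerate binary forms\<close>

text \<open>In the convolution sum an index below \<open>i\<close> kills the second factor and an
  index above \<open>i\<close> the first. The degrees are only bounded, because the top coefficients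
  may vanish.\<close>

lemma coeff_mult_top:
  fixes p q :: "'a::comm_semiring_0 poly"
  assumes "degree p \<le> i" "degree q \<le> j"
  shows "coeff (p * q) (i + j) = coeff p i * coeff q j"
proof -
  have "coeff p k * coeff q (i + j - k) = 0" if "k \<noteq> i" "k \<le> i + j" for k
    using that assms by (cases "k < i") (auto simp: coeff_eq_0)
  then have "(\<Sum>k\<le>i + j. coeff p k * coeff q (i + j - k)) =
      (\<Sum>k\<le>i + j. if k = i then coeff p i * coeff q j else 0)"
    by (intro sum.cong) auto
  then show ?thesis by (simp add: coeff_mult)
qed

lemma degree_linear_power_le: "degree ([:b, w:] ^ k) \<le> k"
  for w :: "'a::comm_semiring_1"
proof (induction k)
  case (Suc k)
  have "degree ([:b, w:] * [:b, w:] ^ k) \<le> degree [:b, w:] + degree ([:b, w:] ^ k)"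
    by (rule degree_mult_le)
  also have "\<dots> \<le> 1 + k" using Suc by (intro add_mono) auto
  finally show ?case by simp
qed auto

lemma coeff_linear_power_top: "coeff ([:b, w:] ^ k) k = w ^ k"
  for w :: "'a::comm_semiring_1"
proof (induction k)
  case (Suc k)
  then show ?case
    using coeff_mult_top[of "[:b, w:]" 1 "[:b, w:] ^ k" k] degree_linear_power_le[of b w k]
    by simp
qed auto

text \<open>Otherwise the difference would have infinitely many roots. The complex factorization of
  a real form is compared with the form at real parameters only.\<close>

lemma poly_eqI_real:
  fixes p q :: "'a::{real_algebra_1, idom} poly"
  assumes "\<And>t::real. poly p (of_real t) = poly q (of_real t)"
  shows "p = q"
proof (rule ccontr)
  assume "p \<noteq> q"
  then have "finite {x. poly (p - q) x = 0}" by (intro poly_roots_finite) auto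
  moreover have "range (of_real :: real \<Rightarrow> 'a) \<subseteq> {x. poly (p - q) x = 0}" using assms by auto
  moreover have "infinite (range (of_real :: real \<Rightarrow> 'a))"
    by (metis finite_imageD infinite_UNIV_char_0 inj_of_real)
  ultimately show False using finite_subset by blast
qed

lemma sum_power_coeff_eq:
  fixes a b :: "_ \<Rightarrow> real"
  assumes "finite I" "finite J"
    and "\<And>t. (\<Sum>i\<in>I. a i * t ^ k i) = (\<Sum>j\<in>J. b j * t ^ l j)"
  shows "(\<Sum>i | i \<in> I \<and> k i = d. a i) = (\<Sum>j | j \<in> J \<and> l j = d. b j)"
proof -
  have "(\<Sum>i\<in>I. monom (a i) (k i)) = (\<Sum>j\<in>J. monom (b j) (l j))"
    using assms(3) by (intro poly_eqI_real) (simp add: poly_sum poly_monom)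
  then have "coeff (\<Sum>i\<in>I. monom (a i) (k i)) d = coeff (\<Sum>j\<in>J. monom (b j) (l j)) d" by simp
  then show ?thesis using assms(1,2) by (simp add: coeff_sum sum.inter_filter)
qed

abbreviation eval_real :: "(real, 'n::finite) mvpoly \<Rightarrow> real ^ 'n \<Rightarrow> real" where
  "eval_real \<equiv> eval_mvpoly (\<lambda>c. c)"

text \<open>Each monomial of degree \<open>m\<close> turns into a product of \<open>m\<close> linear
  polynomials in \<open>r\<close>, whose coefficient of \<open>r ^ m\<close> does not involve
  \<open>b\<close>. Hence translations leave the part of top degree unchanged.\<close>

lemma homogeneous_affine_line:
  fixes h :: "(real, 2) mvpoly"
  assumes "homogeneous m h"
  obtains H where "\<And>r. poly H r = eval_real h (r *\<^sub>R w + b)" "coeff H m = eval_real h w"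
proof
  let ?H = "\<Sum>\<beta>\<in>Poly_Mapping.keys h. smult (Poly_Mapping.lookup h \<beta>)
      ([:b $ 1, w $ 1:] ^ (\<beta> $ 1) * [:b $ 2, w $ 2:] ^ (\<beta> $ 2))"
  show "poly ?H r = eval_real h (r *\<^sub>R w + b)" for r
    by (simp add: eval_mvpoly_def poly_sum UNIV_2 add.commute)
  have "coeff ([:b $ 1, w $ 1:] ^ (\<beta> $ 1) * [:b $ 2, w $ 2:] ^ (\<beta> $ 2)) m =
      w $ 1 ^ (\<beta> $ 1) * w $ 2 ^ (\<beta> $ 2)" if "\<beta> \<in> Poly_Mapping.keys h" for \<beta>
  proof -
    have "m = \<beta> $ 1 + \<beta> $ 2" using assms that by (auto simp: homogeneous_def sum_2)
    then show ?thesis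
      by (simp add: coeff_mult_top degree_linear_power_le coeff_linear_power_top)
  qed
  then show "coeff ?H m = eval_real h w"
    by (simp add: eval_mvpoly_def coeff_sum UNIV_2)
qed

section \<open>Complex linear forms and their zeros\<close>

lemma linear_form_expand:
  fixes l :: "('a::comm_semiring_1, 2) mvpoly"
  assumes "homogeneous 1 l"
  shows "l = Poly_Mapping.single (axis 1 1) (Poly_Mapping.lookup l (axis 1 1)) +
             Poly_Mapping.single (axis 2 1) (Poly_Mapping.lookup l (axis 2 1))"
proof (intro poly_mapping_eqI)
  fix \<alpha> :: "nat ^ 2"
  have ne: "axis 1 1 \<noteq> (axis 2 1 :: nat ^ 2)" by (simp add: axis_eq_axis)
  have "\<alpha> = axis 1 1 \<or> \<alpha> = axis 2 1" if "\<alpha> \<in> Poly_Mapping.keys l"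
  proof -
    have "\<alpha> $ 1 + \<alpha> $ 2 = 1" using assms that by (auto simp: homogeneous_def sum_2)
    then consider "\<alpha> $ 1 = 1" "\<alpha> $ 2 = 0" | "\<alpha> $ 1 = 0" "\<alpha> $ 2 = 1" by linarith
    then show ?thesis by cases (simp_all add: vec_eq_iff forall_2 axis_def)
  qed
  then show "Poly_Mapping.lookup l \<alpha> = Poly_Mapping.lookup
     (Poly_Mapping.single (axis 1 1) (Poly_Mapping.lookup l (axis 1 1)) +
      Poly_Mapping.single (axis 2 1) (Poly_Mapping.lookup l (axis 2 1))) \<alpha>"
    using ne by (auto simp: lookup_add lookup_single when_def in_keys_iff)
qed

lemma eval_linear_form:
  fixes l :: "(complex, 2) mvpoly"
  assumes "homogeneous 1 l"
  shows "eval_mvpoly (\<lambda>c. c) l x =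
    Poly_Mapping.lookup l (axis 1 1) * x $ 1 + Poly_Mapping.lookup l (axis 2 1) * x $ 2"
  by (subst linear_form_expand[OF assms])
     (simp add: complex_eval.eval_add eval_mvpoly_single UNIV_2 axis_def)

text \<open>The coefficient vectors of both forms annihilate the same nonzero vector of the plane,
  so their determinant vanishes and they are proportional.\<close>

lemma linear_forms_common_zero:
  fixes l l' :: "(complex, 2) mvpoly"
  assumes "homogeneous 1 l" "homogeneous 1 l'" "l' \<noteq> 0" "x \<noteq> 0"
    and "eval_mvpoly (\<lambda>c. c) l x = 0" "eval_mvpoly (\<lambda>c. c) l' x = 0"
  shows "\<exists>t. l = Const t * l'"
proof -
  define p where "p = Poly_Mapping.lookup l (axis 1 1)"
  define q where "q = Poly_Mapping.lookup l (axis 2 1)"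
  define p' where "p' = Poly_Mapping.lookup l' (axis 1 1)"
  define q' where "q' = Poly_Mapping.lookup l' (axis 2 1)"
  have l: "l = Poly_Mapping.single (axis 1 1) p + Poly_Mapping.single (axis 2 1) q"
    using linear_form_expand[OF assms(1)] by (simp add: p_def q_def)
  have l': "l' = Poly_Mapping.single (axis 1 1) p' + Poly_Mapping.single (axis 2 1) q'"
    using linear_form_expand[OF assms(2)] by (simp add: p'_def q'_def)
  have e: "p * x $ 1 + q * x $ 2 = 0" "p' * x $ 1 + q' * x $ 2 = 0"
    using assms(5,6) by (simp_all add: eval_linear_form assms(1,2) p_def q_def p'_def q'_def del: One_nat_def)
  have "(p * q' - q * p') * x $ 1 = 0" "(p * q' - q * p') * x $ 2 = 0"
    using e by algebra+
  moreover have "x $ 1 \<noteq> 0 \<or> x $ 2 \<noteq> 0" using assms(4) by (auto simp: vec_eq_iff forall_2)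
  ultimately have d: "p * q' = q * p'" by auto
  have "p' \<noteq> 0 \<or> q' \<noteq> 0" using assms(3) l' by auto
  then obtain t where "p = t * p'" "q = t * q'"
  proof
    assume "p' \<noteq> 0"
    then show ?thesis using d by (intro that[of "p / p'"]) (auto simp: field_simps)
  next
    assume "q' \<noteq> 0"
    then show ?thesis using d by (intro that[of "q / q'"]) (auto simp: field_simps)
  qed
  then have "l = Const t * l'" unfolding l l' by (simp add: Const_def distrib_left mult_single)
  then show ?thesis ..
qed

lemma eval_map_complex_of_real:
  "eval_mvpoly (\<lambda>c. c) (Poly_Mapping.map complex_of_real h) (\<chi> i. complex_of_real (x $ i)) =
   complex_of_real (eval_real h x)"
proof -
  have "Poly_Mapping.keys (Poly_Mapping.map complex_of_real h) \<subseteq> Poly_Mapping.keys h"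
    by (auto simp: in_keys_iff map.rep_eq when_def)
  then show ?thesis
    by (subst eval_mvpoly_superset[of "Poly_Mapping.keys h"])
       (auto simp: eval_mvpoly_def map.rep_eq when_def in_keys_iff intro!: sum.cong)
qed

text \<open>Up to a constant, \<open>h (u + t v)\<close> is a product of factors that are affine in
  \<open>t\<close>. If \<open>t\<^sup>2\<close> divided it, two of them would vanish at
  \<open>t = 0\<close>, since by independence of \<open>u\<close> and \<open>v\<close> each factor
  has at most a simple zero there. Two linear forms vanishing at \<open>u\<close> are proportional,
  which non-degeneracy forbids. The expansion may repeat exponents, so that it can be indexed by the
  monomials of a polynomial in more variables.\<close>

lemma nondegenerate_no_double_zero:
  fixes u v :: "real ^ 2"
  assumes "nondegenerate h" and det: "u $ 1 * v $ 2 \<noteq> u $ 2 * v $ 1" and "finite I"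
    and eq: "\<And>t. eval_real h (u + t *\<^sub>R v) = (\<Sum>i\<in>I. a i * t ^ k i)"
  shows "\<exists>i\<in>I. k i \<le> 1"
proof (rule ccontr)
  assume "\<not> ?thesis"
  then have k: "k i \<ge> 2" if "i \<in> I" for i using that by force
  obtain c and ls :: "(complex, 2) mvpoly list" where "h \<noteq> 0"
    and fac: "Poly_Mapping.map complex_of_real h = Const c * prod_list ls"
    and lin: "\<forall>l\<in>set ls. l \<noteq> 0 \<and> homogeneous 1 l"
    and ndg: "\<forall>i<length ls. \<forall>j<length ls. i \<noteq> j \<longrightarrow> \<not> (\<exists>t. ls ! i = Const t * ls ! j)"
    using assms(1) unfolding nondegenerate_def by (elim conjE exE) (rule that)
  have "c \<noteq> 0"
  proof
    assume "c = 0"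
    then have "Poly_Mapping.map complex_of_real h = 0" using fac by (simp add: Const_def)
    then have "\<forall>k\<in>Poly_Mapping.keys h. complex_of_real (Poly_Mapping.lookup h k) = 0"
      by (simp only: Poly_Mapping.map_eq_zero_iff)
    then have "h = 0" by (intro poly_mapping_eqI) (auto simp: in_keys_iff)
    then show False using \<open>h \<noteq> 0\<close> by simp
  qed
  define u' where "u' = (\<chi> i. complex_of_real (u $ i))"
  define v' where "v' = (\<chi> i. complex_of_real (v $ i))"
  define e where "e i x = eval_mvpoly (\<lambda>c. c) (ls ! i) x" for i and x :: "complex ^ 2"
  let ?n = "length ls"
  have hom: "homogeneous 1 (ls ! i)" "ls ! i \<noteq> 0" if "i < ?n" for i
    using lin that by simp_all
  have "u' \<noteq> 0" using det by (auto simp: u'_def vec_eq_iff forall_2)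
  have zero_unique: "i = j" if "i < ?n" "j < ?n" "e i u' = 0" "e j u' = 0" for i j
    using linear_forms_common_zero[OF hom(1)[OF that(1)] hom[OF that(2)] \<open>u' \<noteq> 0\<close>] that ndg
    unfolding e_def by blast
  \<comment> \<open>A linear form that vanishes at two independent vectors is zero.\<close>
  have zero_simple: "e i v' \<noteq> 0" if "i < ?n" "e i u' = 0" for i
  proof
    assume "e i v' = 0"
    define p q where "p = Poly_Mapping.lookup (ls ! i) (axis 1 1)"
      and "q = Poly_Mapping.lookup (ls ! i) (axis 2 1)"
    have *: "p * u $ 1 + q * u $ 2 = 0" "p * v $ 1 + q * v $ 2 = 0"
      using \<open>e i v' = 0\<close> that(2) hom[OF that(1)]
      by (simp_all add: e_def eval_linear_form u'_def v'_def p_def q_def del: One_nat_def)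
    have "complex_of_real (u $ 1 * v $ 2) \<noteq> complex_of_real (u $ 2 * v $ 1)"
      using det of_real_eq_iff by blast
    then have "of_real (u $ 1) * of_real (v $ 2) - of_real (u $ 2) * of_real (v $ 1) \<noteq> (0::complex)"
      by simp
    moreover have "p * (of_real (u $ 1) * of_real (v $ 2) - of_real (u $ 2) * of_real (v $ 1)) = 0"
      "q * (of_real (u $ 1) * of_real (v $ 2) - of_real (u $ 2) * of_real (v $ 1)) = 0"
      using * by algebra+
    ultimately have "p = 0" "q = 0" by auto
    then show False using linear_form_expand[OF hom(1)[OF that(1)]] hom(2)[OF that(1)]
      by (simp add: p_def q_def del: One_nat_def)
  qed
  define F where "F J = (\<Prod>i\<in>J. [:e i u', e i v':])" for J :: "nat set"
  have line: "(\<chi> i. complex_of_real ((u + t *\<^sub>R v) $ i)) = u' + of_real t *s v'" for t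
    by (simp add: u'_def v'_def vec_eq_iff)
  have e_line: "e i (u' + s *s v') = e i u' + s * e i v'" if "i < ?n" for i s
    using hom[OF that] by (simp add: e_def eval_linear_form algebra_simps del: One_nat_def)
  have pl: "eval_mvpoly (\<lambda>c. c) (prod_list ls) x = (\<Prod>i<?n. e i x)" for x
    by (simp add: prod.list_conv_set_nth complex_eval.eval_prod e_def atLeast0LessThan)
  have P: "smult c (F {..<?n}) = (\<Sum>i\<in>I. monom (of_real (a i)) (k i))"
  proof (rule poly_eqI_real)
    fix t :: real
    have "poly (smult c (F {..<?n})) (of_real t) = c * (\<Prod>i<?n. e i (u' + of_real t *s v'))"
      by (simp add: F_def poly_prod e_line)
    also have "\<dots> = eval_mvpoly (\<lambda>c. c) (Poly_Mapping.map complex_of_real h)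
        (\<chi> i. complex_of_real ((u + t *\<^sub>R v) $ i))"
      unfolding fac line by (simp add: complex_eval.eval_mult complex_eval.eval_Const pl)
    also have "\<dots> = of_real (\<Sum>i\<in>I. a i * t ^ k i)"
      unfolding eval_map_complex_of_real eq ..
    finally show "poly (smult c (F {..<?n})) (of_real t) =
        poly (\<Sum>i\<in>I. monom (of_real (a i)) (k i)) (of_real t)"
      by (simp add: poly_sum poly_monom)
  qed
  have "coeff (smult c (F {..<?n})) d = 0" if "d < 2" for d
    unfolding P coeff_sum coeff_monom using k that by (intro sum.neutral) force
  then have c01: "coeff (F {..<?n}) 0 = 0" "coeff (F {..<?n}) 1 = 0"
    using \<open>c \<noteq> 0\<close> by force+
  have F0: "coeff (F J) 0 = (\<Prod>i\<in>J. e i u')" for J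
    by (simp add: F_def flip: poly_0_coeff_0) (simp add: poly_prod)
  from c01(1) obtain i where i: "i < ?n" "e i u' = 0"
    unfolding F0 by auto
  \<comment> \<open>The factor \<open>i\<close> has zero constant term, so the coefficient of
    \<open>t\<close> in the product is \<open>e i v'\<close> times the constant term of the
    remaining product. That term must vanish, which yields a second factor vanishing at
    \<open>u'\<close>.\<close>
  have "F {..<?n} = [:e i u', e i v':] * F ({..<?n} - {i})"
    unfolding F_def using i by (subst prod.remove[of _ i]) auto
  then have "coeff (F {..<?n}) 1 = e i v' * (\<Prod>j\<in>{..<?n} - {i}. e j u')"
    using i by (simp add: F0)
  then have "(\<Prod>j\<in>{..<?n} - {i}. e j u') = 0"
    using c01(2) zero_simple[OF i] by simp
  then obtain j where "j < ?n" "j \<noteq> i" "e j u' = 0" by auto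
  then show False using zero_unique i by blast
qed

subsection \<open>Exponents of the transformed phase\<close>

locale osc_phase =
  fixes s n :: nat and N :: "nat \<Rightarrow> nat" and h :: "nat \<Rightarrow> (real, 2) mvpoly"
    and S :: "(real, 3) mvpoly"
  assumes s_pos: "s \<ge> 1" and N_pos: "0 < N 1" and N_mono: "strict_mono_on {1..s} N"
    and N_less: "N s < n"
    and hom: "\<And>j. j \<in> {1..s} \<Longrightarrow> homogeneous (n - N j) (h (n - N j))"
    and ndg_first: "nondegenerate (h (n - N 1))" and ndg_last: "nondegenerate (h (n - N s))"
    and S_eq: "S = (\<Sum>j=1..s. Var 3 ^ N j * eval_mvpoly Const (h (n - N j)) (vector [Var 1, Var 2]))"
begin

lemma N_bounds:
  assumes "j \<in> {1..s}"
  shows "N 1 \<le> N j" "N j \<le> N s" "N j < n"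
proof -
  have "mono_on {1..s} N" using N_mono by (rule strict_mono_on_imp_mono_on)
  then show "N 1 \<le> N j" "N j \<le> N s" using assms s_pos by (auto simp: mono_on_def)
  then show "N j < n" using N_less by simp
qed

lemma N_eq_iff: "i \<in> {1..s} \<Longrightarrow> j \<in> {1..s} \<Longrightarrow> N i = N j \<longleftrightarrow> i = j"
  by (rule inj_on_eq_iff[OF strict_mono_on_imp_inj_on[OF N_mono]])

lemma eval_S:
  "eval_real S (vector [x $ 1, x $ 2, y]) = (\<Sum>j=1..s. y ^ N j * eval_real (h (n - N j)) x)"
proof -
  have "(\<chi> i. x $ i) = x" by (simp add: vec_eq_iff)
  then show ?thesis
    unfolding S_eq
    by (simp add: real_eval.eval_sum real_eval.eval_mult real_eval.eval_power real_eval.eval_Var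
        real_eval.eval_subst vec_2_eta)
qed

text \<open>The keys of a sum lie among the keys of its summands, and each summand lives in a single
  layer of fixed \<open>y\<close>-exponent.\<close>

lemma keys_S:
  assumes "\<alpha> \<in> Poly_Mapping.keys S"
  shows "\<exists>j\<in>{1..s}. \<alpha> $ 3 = N j \<and> \<alpha> $ 1 + \<alpha> $ 2 = n - N j"
proof -
  have "Poly_Mapping.keys S \<subseteq> (\<Union>j\<in>{1..s}. \<Union>\<beta>\<in>Poly_Mapping.keys (h (n - N j)).
      Poly_Mapping.keys (Poly_Mapping.single (vector [\<beta> $ 1, \<beta> $ 2, N j] :: nat ^ 3)
        (Poly_Mapping.lookup (h (n - N j)) \<beta>)))"
    unfolding S_eq Var3_power_times_subst
    by (intro order.trans[OF keys_sum] UN_mono order.refl)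
  with assms obtain j \<beta> where j: "j \<in> {1..s}" and "\<beta> \<in> Poly_Mapping.keys (h (n - N j))"
    and \<alpha>: "\<alpha> = vector [\<beta> $ 1, \<beta> $ 2, N j]"
    by (auto simp del: atLeastAtMost_iff split: if_splits)
  then have "\<beta> $ 1 + \<beta> $ 2 = n - N j"
    using hom[OF j] by (simp add: homogeneous_def sum_2)
  then show ?thesis using j unfolding \<alpha> by (intro bexI[of _ j]) auto
qed

text \<open>Evaluate the transformed phase at \<open>(r v, r y)\<close> and compare the coefficients
  of \<open>r ^ n\<close>. On the side of \<open>Q\<close> they collect the monomials of total
  degree \<open>n\<close>; on the other side they give the forms at \<open>A v\<close>, without the
  translation. Comparing powers of \<open>y\<close> then isolates one layer.\<close>

lemma top_part_affine_subst:
  fixes A b defines "Q \<equiv> affine_subst A b S"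
  assumes j: "j \<in> {1..s}"
  shows "eval_real (h (n - N j)) (A *v v) =
    (\<Sum>\<alpha> | \<alpha> \<in> Poly_Mapping.keys Q \<and> \<alpha> $ 1 + \<alpha> $ 2 + \<alpha> $ 3 = n \<and> \<alpha> $ 3 = N j.
       Poly_Mapping.lookup Q \<alpha> * (v $ 1 ^ (\<alpha> $ 1) * v $ 2 ^ (\<alpha> $ 2)))"
proof -
  let ?c = "\<lambda>\<alpha>. Poly_Mapping.lookup Q \<alpha> * (v $ 1 ^ (\<alpha> $ 1) * v $ 2 ^ (\<alpha> $ 2))"
  let ?K = "{\<alpha> \<in> Poly_Mapping.keys Q. \<alpha> $ 1 + \<alpha> $ 2 + \<alpha> $ 3 = n}"
  define w where "w = A *v v"
  have "\<forall>j\<in>{1..s}. \<exists>H. (\<forall>r. poly H r = eval_real (h (n - N j)) (r *\<^sub>R w + b)) \<and>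
      coeff H (n - N j) = eval_real (h (n - N j)) w"
  proof
    fix j assume "j \<in> {1..s}"
    from homogeneous_affine_line[OF hom[OF this], of w b]
    obtain H where "\<And>r. poly H r = eval_real (h (n - N j)) (r *\<^sub>R w + b)"
      "coeff H (n - N j) = eval_real (h (n - N j)) w" by metis
    then show "\<exists>H. (\<forall>r. poly H r = eval_real (h (n - N j)) (r *\<^sub>R w + b)) \<and>
      coeff H (n - N j) = eval_real (h (n - N j)) w" by blast
  qed
  from bchoice[OF this]
  obtain H where H: "\<forall>j\<in>{1..s}. (\<forall>r. poly (H j) r = eval_real (h (n - N j)) (r *\<^sub>R w + b)) \<and>
      coeff (H j) (n - N j) = eval_real (h (n - N j)) w" ..
  have top: "(\<Sum>\<alpha>\<in>?K. ?c \<alpha> * y ^ (\<alpha> $ 3)) = (\<Sum>j=1..s. eval_real (h (n - N j)) w * y ^ N j)" for y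
  proof -
    let ?P = "\<Sum>\<alpha>\<in>Poly_Mapping.keys Q. monom (?c \<alpha> * y ^ (\<alpha> $ 3)) (\<alpha> $ 1 + \<alpha> $ 2 + \<alpha> $ 3)"
    let ?R = "\<Sum>j=1..s. monom (y ^ N j) (N j) * H j"
    have "?P = ?R"
    proof (rule poly_eqI_real)
      fix r :: real
      have "poly ?P r = eval_real Q (vector [(r *\<^sub>R v) $ 1, (r *\<^sub>R v) $ 2, r * y])"
        by (simp add: poly_sum poly_monom eval_mvpoly_def prod_3 power_mult_distrib power_add mult_ac)
      also have "\<dots> = (\<Sum>j=1..s. (r * y) ^ N j * eval_real (h (n - N j)) (r *\<^sub>R w + b))"
        unfolding Q_def eval_affine_subst eval_S
        by (simp add: w_def matrix_vector_mult_scaleR)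
      also have "\<dots> = poly ?R r"
        by (simp add: poly_sum poly_monom H[rule_format, THEN conjunct1] power_mult_distrib mult_ac)
      finally show "poly ?P (of_real r) = poly ?R (of_real r)" by simp
    qed
    then have "coeff ?P n = coeff ?R n" by simp
    moreover have "coeff (monom (y ^ N j) (N j) * H j) n = eval_real (h (n - N j)) w * y ^ N j"
      if "j \<in> {1..s}" for j
      using N_bounds(3)[OF that] H[rule_format, OF that] by (simp add: coeff_monom_mult)
    ultimately show ?thesis by (simp add: coeff_sum sum.inter_filter)
  qed
  have "(\<Sum>\<alpha> | \<alpha> \<in> ?K \<and> \<alpha> $ 3 = N j. ?c \<alpha>) =
      (\<Sum>i | i \<in> {1..s} \<and> N i = N j. eval_real (h (n - N i)) w)"
    by (rule sum_power_coeff_eq[OF _ _ top]) auto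
  \<comment> \<open>Strict monotonicity of \<open>N\<close> keeps different forms in different
    layers.\<close>
  also have "{i. i \<in> {1..s} \<and> N i = N j} = {j}" using N_eq_iff j by auto
  finally show ?thesis by (simp add: w_def conj_assoc)
qed

text \<open>On \<open>v = (1, t)\<close> the power of \<open>t\<close> is the exponent of the second
  variable, on \<open>v = (t, 1)\<close> that of the first. Invertibility makes the images of the
  coordinate vectors independent, so a non-degenerate form has no double zero at
  \<open>t = 0\<close>.\<close>

lemma affine_subst_keys:
  assumes "invertible A" "j \<in> {1..s}" "nondegenerate (h (n - N j))"
  shows "\<exists>\<alpha>\<in>Poly_Mapping.keys (affine_subst A b S).
      \<alpha> $ 1 + \<alpha> $ 2 + \<alpha> $ 3 = n \<and> \<alpha> $ 3 = N j \<and> \<alpha> $ 2 \<le> 1"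
    and "\<exists>\<alpha>\<in>Poly_Mapping.keys (affine_subst A b S).
      \<alpha> $ 1 + \<alpha> $ 2 + \<alpha> $ 3 = n \<and> \<alpha> $ 3 = N j \<and> \<alpha> $ 1 \<le> 1"
proof -
  let ?K = "{\<alpha> \<in> Poly_Mapping.keys (affine_subst A b S). \<alpha> $ 1 + \<alpha> $ 2 + \<alpha> $ 3 = n \<and> \<alpha> $ 3 = N j}"
  let ?c = "\<lambda>\<alpha>. Poly_Mapping.lookup (affine_subst A b S) \<alpha>"
  have det: "A $ 1 $ 1 * A $ 2 $ 2 \<noteq> A $ 1 $ 2 * A $ 2 $ 1"
    using assms(1) by (simp add: invertible_det_nz det_2)
  have "\<exists>\<alpha>\<in>?K. \<alpha> $ 2 \<le> 1"
  proof (rule nondegenerate_no_double_zero[OF assms(3), of "A *v vector [1, 0]" "A *v vector [0, 1]"])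
    show "eval_real (h (n - N j)) (A *v vector [1, 0] + t *\<^sub>R (A *v vector [0, 1])) =
        (\<Sum>\<alpha>\<in>?K. ?c \<alpha> * t ^ (\<alpha> $ 2))" for t
    proof -
      have "A *v vector [1, 0] + t *\<^sub>R (A *v vector [0, 1]) = A *v vector [1, t]"
        by (simp add: vec_eq_iff forall_2 matrix_vector_mult_def sum_2)
      then show ?thesis
        by (simp only: top_part_affine_subst[OF assms(2), where b = b] vector_2) simp
    qed
  qed (use det in \<open>simp_all add: matrix_vector_mult_def sum_2 mult.commute\<close>)
  then show "\<exists>\<alpha>\<in>Poly_Mapping.keys (affine_subst A b S).
      \<alpha> $ 1 + \<alpha> $ 2 + \<alpha> $ 3 = n \<and> \<alpha> $ 3 = N j \<and> \<alpha> $ 2 \<le> 1" by blast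
  have "\<exists>\<alpha>\<in>?K. \<alpha> $ 1 \<le> 1"
  proof (rule nondegenerate_no_double_zero[OF assms(3), of "A *v vector [0, 1]" "A *v vector [1, 0]"])
    show "eval_real (h (n - N j)) (A *v vector [0, 1] + t *\<^sub>R (A *v vector [1, 0])) =
        (\<Sum>\<alpha>\<in>?K. ?c \<alpha> * t ^ (\<alpha> $ 1))" for t
    proof -
      have "A *v vector [0, 1] + t *\<^sub>R (A *v vector [1, 0]) = A *v vector [t, 1]"
        by (simp add: vec_eq_iff forall_2 matrix_vector_mult_def sum_2)
      then show ?thesis
        by (simp only: top_part_affine_subst[OF assms(2), where b = b] vector_2) simp
    qed
  qed (use det in \<open>simp_all add: matrix_vector_mult_def sum_2 mult.commute\<close>)
  then show "\<exists>\<alpha>\<in>Poly_Mapping.keys (affine_subst A b S).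
      \<alpha> $ 1 + \<alpha> $ 2 + \<alpha> $ 3 = n \<and> \<alpha> $ 3 = N j \<and> \<alpha> $ 1 \<le> 1" by blast
qed

end

subsection \<open>The Newton polyhedron and the modified Newton distance\<close>

text \<open>Forming convex hulls commutes with sums of sets, and the orthant is already convex. This
  form gives closedness and upward closure.\<close>

lemma newton_polyhedron_sums:
  fixes p :: "('a::zero, 'n::finite) mvpoly"
  shows "newton_polyhedron p =
     convex hull ((\<lambda>\<alpha>. \<chi> i. real (\<alpha> $ i)) ` Poly_Mapping.keys p) + {v. \<forall>i. 0 \<le> v $ i}"
proof -
  let ?R = "(\<lambda>\<alpha>. \<chi> i. real (\<alpha> $ i)) :: nat ^ 'n \<Rightarrow> real ^ 'n"
  let ?O = "{v :: real ^ 'n. \<forall>i. 0 \<le> v $ i}"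
  have "(\<Union>\<alpha>\<in>Poly_Mapping.keys p. {v. \<forall>i. real (\<alpha> $ i) \<le> v $ i}) = ?R ` Poly_Mapping.keys p + ?O"
  proof (intro equalityI subsetI)
    fix v assume "v \<in> (\<Union>\<alpha>\<in>Poly_Mapping.keys p. {v. \<forall>i. real (\<alpha> $ i) \<le> v $ i})"
    then obtain \<alpha> where \<alpha>: "\<alpha> \<in> Poly_Mapping.keys p" "\<And>i. real (\<alpha> $ i) \<le> v $ i" by auto
    then have "?R \<alpha> + (v - ?R \<alpha>) \<in> ?R ` Poly_Mapping.keys p + ?O"
      by (intro set_plus_intro) auto
    then show "v \<in> ?R ` Poly_Mapping.keys p + ?O" by simp
  qed (force elim!: set_plus_elim)
  moreover have "convex ?O" by (auto simp: convex_def)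
  ultimately show ?thesis
    by (simp add: newton_polyhedron_def convex_hull_set_plus hull_same)
qed

text \<open>The sum of a compact set, the hull of finitely many points, and a closed set is
  closed.\<close>

lemma closed_newton_polyhedron: "closed (newton_polyhedron (p :: ('a::zero, 'n::finite) mvpoly))"
proof -
  have "closed {v :: real ^ 'n. \<forall>i. 0 \<le> v $ i}"
    by (intro closed_Collect_all closed_Collect_le continuous_intros)
  moreover have sums: "A + B = (\<Union>x\<in>A. \<Union>y\<in>B. {x + y})" for A B :: "(real ^ 'n) set"
    by (auto simp: set_plus_def)
  ultimately show ?thesis
    unfolding newton_polyhedron_sums sums
    by (intro compact_closed_sums finite_imp_compact_convex_hull) simp_all
qed

lemma convex_newton_polyhedron: "convex (newton_polyhedron p)"
  by (simp add: newton_polyhedron_def convex_convex_hull)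

lemma newton_polyhedron_upward:
  assumes "u \<in> newton_polyhedron p" "\<And>i. u $ i \<le> v $ i"
  shows "v \<in> newton_polyhedron p"
proof -
  obtain x y where "x \<in> convex hull ((\<lambda>\<alpha>. \<chi> i. real (\<alpha> $ i)) ` Poly_Mapping.keys p)"
    "y \<in> {v. \<forall>i. 0 \<le> v $ i}" "u = x + y"
    using assms(1) unfolding newton_polyhedron_sums by (rule set_plus_elim)
  moreover have "y + (v - u) \<in> {v. \<forall>i. 0 \<le> v $ i}"
    using assms(2) \<open>y \<in> {v. \<forall>i. 0 \<le> v $ i}\<close> by (auto intro: add_nonneg_nonneg)
  ultimately have "x + (y + (v - u)) \<in> newton_polyhedron p"
    unfolding newton_polyhedron_sums by (intro set_plus_intro)
  then show ?thesis using \<open>u = x + y\<close> by simp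
qed

lemma key_in_newton_polyhedron:
  "\<alpha> \<in> Poly_Mapping.keys p \<Longrightarrow> (\<chi> i. real (\<alpha> $ i)) \<in> newton_polyhedron p"
  unfolding newton_polyhedron_def by (rule hull_inc) auto

text \<open>For nonnegative weights the half-space contains the whole orthant above each exponent,
  and it is convex.\<close>

lemma newton_polyhedron_weight_ge:
  assumes "v \<in> newton_polyhedron p" "\<And>i. 0 \<le> w $ i"
    and "\<And>\<alpha>. \<alpha> \<in> Poly_Mapping.keys p \<Longrightarrow> c \<le> (\<Sum>i\<in>UNIV. w $ i * real (\<alpha> $ i))"
  shows "c \<le> (\<Sum>i\<in>UNIV. w $ i * v $ i)"
proof -
  have "newton_polyhedron p \<subseteq> {v. inner w v \<ge> c}"
    unfolding newton_polyhedron_def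
  proof (rule hull_minimal)
    show "(\<Union>\<alpha>\<in>Poly_Mapping.keys p. {v. \<forall>i. real (\<alpha> $ i) \<le> v $ i}) \<subseteq> {v. inner w v \<ge> c}"
      by (auto simp: inner_vec_def intro!: order.trans[OF assms(3)] sum_mono mult_left_mono assms(2))
  qed (rule convex_halfspace_ge)
  then show ?thesis using assms(1) by (auto simp: inner_vec_def)
qed

text \<open>The \<open>LEAST\<close> over the reals is meaningful only if the infimum is attained;
  closedness of the polyhedron ensures this.\<close>

lemma newton_distance_le:
  assumes "0 \<le> d" "(\<chi> i. d) \<in> newton_polyhedron p"
  shows "newton_distance p \<le> d"
proof -
  define T where "T = {t. 0 \<le> t \<and> (\<chi> i. t) \<in> newton_polyhedron p}"
  have "closed T"
  proof -
    have "closed ((\<lambda>t. \<chi> i. t) -` newton_polyhedron p)"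
      by (intro continuous_closed_vimage closed_newton_polyhedron continuous_intros)
    then have "closed ({0..} \<inter> (\<lambda>t. \<chi> i. t) -` newton_polyhedron p)" by (intro closed_Int) auto
    also have "{0..} \<inter> (\<lambda>t. \<chi> i. t) -` newton_polyhedron p = T" by (auto simp: T_def)
    finally show ?thesis .
  qed
  moreover have "d \<in> T" "bdd_below T" using assms by (auto simp: T_def intro: bdd_belowI[of _ 0])
  ultimately have "Inf T \<in> T" by (intro closed_contains_Inf) auto
  then have "newton_distance p = Inf T"
    unfolding newton_distance_def
    by (intro Least_equality) (auto simp: T_def intro: cInf_lower bdd_belowI[of _ 0])
  then show ?thesis using \<open>d \<in> T\<close> \<open>bdd_below T\<close> by (simp add: cInf_lower)
qed

lemma newton_distance_eq:
  assumes "0 \<le> d" "(\<chi> i. d) \<in> newton_polyhedron p"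
    and "\<And>t. (\<chi> i. t) \<in> newton_polyhedron p \<Longrightarrow> d \<le> t"
  shows "newton_distance p = d"
  unfolding newton_distance_def using assms by (intro Least_equality) auto

text \<open>The two given points lie on one horizontal line of constant coordinate sum, each within
  distance one of a coordinate plane. The segment between them covers all points of the line with
  both coordinates at least one.\<close>

lemma convex_edge_point:
  fixes C :: "(real ^ 3) set"
  assumes "convex C" "vector [p, p', k] \<in> C" "vector [q, q', k] \<in> C"
    and "p + p' = q + q'" "p' \<le> 1" "q \<le> 1" "1 \<le> x" "1 \<le> x'" "x + x' = p + p'"
  shows "vector [x, x', k] \<in> C"
proof (cases "p = q")
  \<comment> \<open>Here \<open>p \<le> 1\<close> and \<open>p' \<le> 1\<close>, while
    \<open>x\<close> and \<open>x'\<close> are at least one and have the same sum; all four numbers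
    equal one.\<close>
  case True
  then have "x = p" "x' = p'" using assms by linarith+
  then show ?thesis using assms by simp
next
  case False
  then have "q < p" using assms by linarith
  define u where "u = (x - q) / (p - q)"
  have u: "0 \<le> u" "u \<le> 1" using assms \<open>q < p\<close> by (auto simp: u_def)
  have x: "x = q + u * (p - q)" using \<open>q < p\<close> by (simp add: u_def)
  have "u *\<^sub>R vector [p, p', k] + (1 - u) *\<^sub>R vector [q, q', k] \<in> C"
    using assms u by (intro convexD) auto
  also have "u *\<^sub>R vector [p, p', k] + (1 - u) *\<^sub>R vector [q, q', k] = (vector [x, x', k] :: real ^ 3)"
  proof -
    have q': "q' = p + p' - q" and x': "x' = p + p' - (q + u * (p - q))" using assms x by linarith+
    show ?thesis unfolding vec_eq_iff forall_3 q' x' x by (simp add: algebra_simps)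
  qed
  finally show ?thesis .
qed

section \<open>The diagonal point and the Newton distance of the phase\<close>

context osc_phase
begin

definition \<delta> :: real where
  "\<delta> = max (max (real n / 3) (real (n - N s) / 2)) (real (N 1))"

lemma \<delta>_ge: "real n / 3 \<le> \<delta>" "real (n - N s) / 2 \<le> \<delta>" "real (N 1) \<le> \<delta>"
  by (auto simp: \<delta>_def)

lemma \<delta>_pos: "0 < \<delta>"
  using \<delta>_ge(3) N_pos by linarith

lemma N_chain: "1 \<le> N 1" "N 1 \<le> N s" "N s < n"
  using N_pos N_less N_bounds(1)[of s] s_pos by auto

text \<open>The layers of heights \<open>N 1\<close> and \<open>N s\<close> contain all points of
  total degree \<open>n\<close> whose horizontal coordinates are at least one. If
  \<open>n / 3\<close> is not strictly between these heights, a single layer suffices; otherwise a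
  segment joining the two layers passes through \<open>(n/3, n/3, n/3)\<close>. Upward closure leads
  from there to the point with all coordinates \<open>\<delta>\<close>.\<close>

lemma diagonal_in_newton_polyhedron:
  assumes "invertible A"
  shows "(\<chi> i. \<delta>) \<in> newton_polyhedron (affine_subst A b S)"
proof -
  define C where "C = newton_polyhedron (affine_subst A b S)"
  have convex: "convex C" by (simp add: C_def convex_newton_polyhedron)
  have up: "(\<chi> i. \<delta>) \<in> C" if "vector [x, x', y] \<in> C" "x \<le> \<delta>" "x' \<le> \<delta>" "y \<le> \<delta>" for x x' y
  proof -
    have "\<forall>i. vector [x, x', y] $ i \<le> (\<chi> i::3. \<delta>) $ i" using that(2-4) by (simp add: forall_3)
    then show ?thesis using newton_polyhedron_upward that(1) unfolding C_def by blast
  qed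
  have key: "\<exists>p p'. p + p' = real (n - N j) \<and> 0 \<le> p \<and> 0 \<le> p' \<and> vector [p, p', real (N j)] \<in> C \<and> p' \<le> 1"
    "\<exists>q q'. q + q' = real (n - N j) \<and> 0 \<le> q \<and> 0 \<le> q' \<and> vector [q, q', real (N j)] \<in> C \<and> q \<le> 1"
    if j: "j \<in> {1..s}" and nd: "nondegenerate (h (n - N j))" for j
  proof -
    have *: "real (\<alpha> $ 1) + real (\<alpha> $ 2) = real (n - N j)"
        "vector [real (\<alpha> $ 1), real (\<alpha> $ 2), real (N j)] \<in> C"
      if "\<alpha> \<in> Poly_Mapping.keys (affine_subst A b S)" "\<alpha> $ 1 + \<alpha> $ 2 + \<alpha> $ 3 = n" "\<alpha> $ 3 = N j" for \<alpha>
      using key_in_newton_polyhedron[OF that(1)] that(2,3)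
      by (auto simp: C_def vec_3_eta)
    from affine_subst_keys(1)[OF assms j nd, of b] obtain \<alpha> where
      \<alpha>: "\<alpha> \<in> Poly_Mapping.keys (affine_subst A b S)" "\<alpha> $ 1 + \<alpha> $ 2 + \<alpha> $ 3 = n" "\<alpha> $ 3 = N j"
      and "\<alpha> $ 2 \<le> 1" by blast
    then show "\<exists>p p'. p + p' = real (n - N j) \<and> 0 \<le> p \<and> 0 \<le> p' \<and> vector [p, p', real (N j)] \<in> C \<and> p' \<le> 1"
      using *[OF \<alpha>] by (intro exI[of _ "real (\<alpha> $ 1)"] exI[of _ "real (\<alpha> $ 2)"]) simp
    from affine_subst_keys(2)[OF assms j nd, of b] obtain \<alpha> where
      \<alpha>: "\<alpha> \<in> Poly_Mapping.keys (affine_subst A b S)" "\<alpha> $ 1 + \<alpha> $ 2 + \<alpha> $ 3 = n" "\<alpha> $ 3 = N j"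
      and "\<alpha> $ 1 \<le> 1" by blast
    then show "\<exists>q q'. q + q' = real (n - N j) \<and> 0 \<le> q \<and> 0 \<le> q' \<and> vector [q, q', real (N j)] \<in> C \<and> q \<le> 1"
      using *[OF \<alpha>] by (intro exI[of _ "real (\<alpha> $ 1)"] exI[of _ "real (\<alpha> $ 2)"]) simp
  qed
  have edge: "vector [x, x', real (N j)] \<in> C"
    if j: "j \<in> {1..s}" "nondegenerate (h (n - N j))" and x: "1 \<le> x" "1 \<le> x'" "x + x' = real (n - N j)" for j x x'
  proof -
    obtain p p' where p: "p + p' = real (n - N j)" "vector [p, p', real (N j)] \<in> C" "p' \<le> 1"
      using key(1)[OF j] by blast
    obtain q q' where q: "q + q' = real (n - N j)" "vector [q, q', real (N j)] \<in> C" "q \<le> 1"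
      using key(2)[OF j] by blast
    show ?thesis
      by (rule convex_edge_point[OF convex p(2) q(2)]) (use p q x in auto)
  qed
  have js: "1 \<in> {1..s}" "s \<in> {1..s}" using s_pos by auto
  note N = N_chain
  have m: "real (n - N 1) = real n - real (N 1)" "real (n - N s) = real n - real (N s)" using N by auto
  consider "real n / 3 \<le> N 1" | "N s \<le> real n / 3" | "N 1 < real n / 3" "real n / 3 < N s" by linarith
  then have "(\<chi> i. \<delta>) \<in> C"
  proof cases
    case 1
    show ?thesis
    proof (cases "n - N 1 \<ge> 2")
      case True
      then have "vector [real (n - N 1) / 2, real (n - N 1) / 2, real (N 1)] \<in> C"
        by (intro edge js ndg_first) auto
      then show ?thesis using 1 \<delta>_ge m by (elim up) auto
    next
      case False
      \<comment> \<open>A form of degree one offers no point with both coordinates at least one, but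
        its exponents are at most \<open>1 \<le> \<delta>\<close> anyway.\<close>
      obtain p p' where p: "p + p' = real (n - N 1)" "0 \<le> p" "0 \<le> p'" "vector [p, p', real (N 1)] \<in> C"
        using key(1)[OF js(1) ndg_first] by blast
      have "real (n - N 1) \<le> 1" using False by linarith
      moreover have "1 \<le> \<delta>" using \<delta>_ge(3) N(1) by linarith
      ultimately show ?thesis using p \<delta>_ge by (intro up[OF p(4)]) auto
    qed
  next
    case 2
    have "n - N s \<ge> 2" using 2 N by linarith
    then have "vector [real (n - N s) / 2, real (n - N s) / 2, real (N s)] \<in> C"
      by (intro edge js ndg_last) auto
    then show ?thesis using 2 \<delta>_ge m by (elim up) auto
  next
    case 3
    \<comment> \<open>The weight of the upper layer for which the combined height is
      \<open>n / 3\<close>.\<close>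
    define \<theta> where "\<theta> = (real n / 3 - N 1) / (real (N s) - N 1)"
    have "N 1 < real (N s)" using 3 by linarith
    then have \<theta>: "0 < \<theta>" "\<theta> < 1" using 3 by (auto simp: \<theta>_def)
    have \<theta>_eq: "\<theta> * (real (N s) - N 1) = real n / 3 - N 1" using \<open>N 1 < real (N s)\<close> by (simp add: \<theta>_def)
    have n3: "real n / 3 \<ge> 1" using 3 N by linarith
    \<comment> \<open>The two inequalities say that the partner point in the layer
      \<open>N 1\<close> has both coordinates at least one, so that \<open>edge\<close> supplies it.
      The midpoint of the upper layer works, with the midpoint of the lower layer as partner; if
      \<open>n - N s = 1\<close>, an exponent with coordinates in \<open>[0, 1]\<close> takes its
      place.\<close>
    have "\<exists>a a'. a + a' = real (n - N s) \<and> vector [a, a', real (N s)] \<in> C \<and>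
      \<theta> * a + (1 - \<theta>) \<le> real n / 3 \<and> \<theta> * a' + (1 - \<theta>) \<le> real n / 3"
    proof (cases "n - N s \<ge> 2")
      case True
      then have "vector [real (n - N s) / 2, real (n - N s) / 2, real (N s)] \<in> C"
        by (intro edge js ndg_last) auto
      moreover have "\<theta> * (real (n - N s) / 2) + (1 - \<theta>) \<le> real n / 3"
      proof -
        have "(1 - \<theta>) * 1 \<le> (1 - \<theta>) * (real (n - N 1) / 2)"
          using \<theta> 3 n3 unfolding m by (intro mult_left_mono) (auto simp: field_simps)
        then have "\<theta> * (real (n - N s) / 2) + (1 - \<theta>) \<le>
            \<theta> * (real (n - N s) / 2) + (1 - \<theta>) * (real (n - N 1) / 2)" by simp
        also have "\<dots> = real n / 3"
          using \<theta>_eq unfolding m by (simp add: field_simps)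
        finally show ?thesis .
      qed
      ultimately show ?thesis
        by (intro exI[of _ "real (n - N s) / 2"]) auto
    next
      case False
      obtain p p' where p: "p + p' = real (n - N s)" "0 \<le> p" "0 \<le> p'" "vector [p, p', real (N s)] \<in> C"
        using key(1)[OF js(2) ndg_last] by blast
      have "p \<le> 1" "p' \<le> 1" using p False by linarith+
      then have "\<theta> * p \<le> \<theta>" "\<theta> * p' \<le> \<theta>" using \<theta> by (auto simp: mult_left_le)
      then show ?thesis using p n3 by (intro exI[of _ p] exI[of _ p']) linarith
    qed
    then obtain a a' where a: "a + a' = real (n - N s)" "vector [a, a', real (N s)] \<in> C"
      "\<theta> * a + (1 - \<theta>) \<le> real n / 3" "\<theta> * a' + (1 - \<theta>) \<le> real n / 3" by blast
    \<comment> \<open>the line from \<open>(a, a', n\<^sub>s)\<close> through \<open>(n/3, n/3, n/3)\<close> meets the layer \<open>n\<^sub>1\<close> at \<open>(?x, ?x', n\<^sub>1)\<close>\<close>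
    let ?x = "(real n / 3 - \<theta> * a) / (1 - \<theta>)" and ?x' = "(real n / 3 - \<theta> * a') / (1 - \<theta>)"
    have "vector [?x, ?x', real (N 1)] \<in> C"
    proof (rule edge[OF js(1) ndg_first])
      show "1 \<le> ?x" "1 \<le> ?x'" using a \<theta> by (auto simp: field_simps)
      have "?x + ?x' = (2 * real n / 3 - \<theta> * (a + a')) / (1 - \<theta>)"
        by (simp add: algebra_simps flip: add_divide_distrib)
      also have "\<dots> = real (n - N 1)"
        using \<theta> \<theta>_eq unfolding a(1) m by (simp add: field_simps)
      finally show "?x + ?x' = real (n - N 1)" .
    qed
    then have "\<theta> *\<^sub>R vector [a, a', real (N s)] + (1 - \<theta>) *\<^sub>R vector [?x, ?x', real (N 1)] \<in> C"
      using \<theta> a convex by (intro convexD) auto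
    also have "\<theta> *\<^sub>R vector [a, a', real (N s)] + (1 - \<theta>) *\<^sub>R vector [?x, ?x', real (N 1)] =
      (vector [real n / 3, real n / 3, real n / 3] :: real ^ 3)"
    proof -
      have "(1 - \<theta>) * ?x = real n / 3 - \<theta> * a" "(1 - \<theta>) * ?x' = real n / 3 - \<theta> * a'"
        using \<theta> by simp_all
      moreover have "\<theta> * real (N s) + (1 - \<theta>) * real (N 1) = real n / 3"
        using \<theta>_eq by (simp add: algebra_simps)
      ultimately show ?thesis unfolding vec_eq_iff forall_3 by simp
    qed
    finally show ?thesis using \<delta>_ge by (elim up)
  qed
  then show ?thesis by (simp add: C_def)
qed

text \<open>The functionals \<open>x\<^sub>1 + x\<^sub>2 + y\<close>,
  \<open>x\<^sub>1 + x\<^sub>2\<close> and \<open>y\<close> are at least \<open>n\<close>,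
  \<open>n - N s\<close> and \<open>N 1\<close> on the exponents of \<open>S\<close>, and they equal
  \<open>3 t\<close>, \<open>2 t\<close> and \<open>t\<close> on the diagonal.\<close>

lemma newton_distance_S: "newton_distance S = \<delta>"
proof (rule newton_distance_eq)
  show "(\<chi> i. \<delta>) \<in> newton_polyhedron S"
    using diagonal_in_newton_polyhedron[of "mat 1" 0] by (simp add: affine_subst_id invertible_det_nz)
  fix t assume t: "(\<chi> i. t) \<in> newton_polyhedron S"
  have weight: "c \<le> (w1 + w2 + w3) * t"
    if "0 \<le> w1" "0 \<le> w2" "0 \<le> w3"
      "\<And>\<alpha>. \<alpha> \<in> Poly_Mapping.keys S \<Longrightarrow> c \<le> w1 * real (\<alpha> $ 1) + w2 * real (\<alpha> $ 2) + w3 * real (\<alpha> $ 3)"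
    for w1 w2 w3 c
  proof -
    have "\<forall>i. 0 \<le> (vector [w1, w2, w3] :: real ^ 3) $ i" using that by (simp add: forall_3)
    then show ?thesis
      using newton_polyhedron_weight_ge[OF t, of "vector [w1, w2, w3]" c] that(4)
      by (simp add: sum_3 algebra_simps)
  qed
  have keys: "\<exists>j. N 1 \<le> N j \<and> N j \<le> N s \<and> N j < n \<and> \<alpha> $ 3 = N j \<and> \<alpha> $ 1 + \<alpha> $ 2 = n - N j"
    if "\<alpha> \<in> Poly_Mapping.keys S" for \<alpha>
    using keys_S[OF that] N_bounds by blast
  have "real n \<le> (1 + 1 + 1) * t"
  proof (rule weight)
    fix \<alpha> assume "\<alpha> \<in> Poly_Mapping.keys S"
    from keys[OF this] have "\<alpha> $ 1 + \<alpha> $ 2 + \<alpha> $ 3 = n" by auto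
    then show "real n \<le> 1 * real (\<alpha> $ 1) + 1 * real (\<alpha> $ 2) + 1 * real (\<alpha> $ 3)" by linarith
  qed auto
  moreover have "real (n - N s) \<le> (1 + 1 + 0) * t"
  proof (rule weight)
    fix \<alpha> assume "\<alpha> \<in> Poly_Mapping.keys S"
    from keys[OF this] have "n - N s \<le> \<alpha> $ 1 + \<alpha> $ 2" by auto
    then show "real (n - N s) \<le> 1 * real (\<alpha> $ 1) + 1 * real (\<alpha> $ 2) + 0 * real (\<alpha> $ 3)" by linarith
  qed auto
  moreover have "real (N 1) \<le> (0 + 0 + 1) * t"
  proof (rule weight)
    fix \<alpha> assume "\<alpha> \<in> Poly_Mapping.keys S"
    from keys[OF this] have "N 1 \<le> \<alpha> $ 3" by auto
    then show "real (N 1) \<le> 0 * real (\<alpha> $ 1) + 0 * real (\<alpha> $ 2) + 1 * real (\<alpha> $ 3)" by linarith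
  qed auto
  ultimately show "\<delta> \<le> t" by (simp add: \<delta>_def)
qed (use \<delta>_pos in simp)

lemma modified_newton_distance_S: "is_modified_newton_distance S \<delta>"
  unfolding is_modified_newton_distance_def
proof (intro conjI allI impI exI)
  show "newton_distance (affine_subst (mat 1) 0 S) = \<delta>"
    by (simp add: affine_subst_id newton_distance_S)
  show "newton_distance (affine_subst A b S) \<le> \<delta>" if "invertible A" for A b
    using diagonal_in_newton_polyhedron[OF that] \<delta>_pos by (intro newton_distance_le) auto
qed (simp add: invertible_det_nz)

end

subsection \<open>The lower bound for the operator norm\<close>

text \<open>The square has area \<open>4 a\<^sup>2\<close>, which fixes the normalizing factor of
  the test function.\<close>

lemma L2_norm_indicator_box:
  assumes "0 < a"
  defines "B \<equiv> cbox (\<chi> i. - a) (\<chi> i. a) :: (real ^ 2) set"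
  shows "L2_norm (\<lambda>x. indicator B x / of_real (2 * a)) = 1"
proof -
  have "emeasure lborel B = ennreal (4 * a\<^sup>2)"
  proof -
    have "B \<noteq> {}" using assms by (auto simp: B_def interval_ne_empty_cart)
    then have "measure lborel B = 4 * a\<^sup>2"
      using content_cbox_cart[of "\<chi> i. - a" "\<chi> i::2. a"]
      by (simp add: B_def prod_constant power2_eq_square)
    moreover have "emeasure lborel B \<noteq> \<infinity>"
      using emeasure_lborel_cbox_finite[of "\<chi> i. - a" "\<chi> i::2. a"] unfolding B_def by simp
    ultimately show ?thesis by (simp add: emeasure_eq_ennreal_measure)
  qed
  moreover have "ennreal ((cmod (indicator B x / of_real (2 * a)))\<^sup>2) = ennreal (1 / (4 * a\<^sup>2)) * indicator B x" for x
    using assms(1) by (auto simp: indicator_def norm_divide power_divide power_mult_distrib)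
  moreover have "B \<in> sets lborel" by (simp add: B_def)
  ultimately have "(\<integral>\<^sup>+ x. ennreal ((cmod (indicator B x / of_real (2 * a)))\<^sup>2) \<partial>lborel) =
      ennreal (1 / (4 * a\<^sup>2)) * ennreal (4 * a\<^sup>2)"
    by (simp add: nn_integral_cmult_indicator)
  also have "\<dots> = 1" using assms(1) by (simp flip: ennreal_mult)
  finally show ?thesis by (simp add: L2_norm_def)
qed

lemma L2_norm_ge_interval:
  fixes g :: "real \<Rightarrow> complex"
  assumes "0 \<le> c" "0 \<le> b" "\<And>y. \<bar>y\<bar> \<le> b \<Longrightarrow> c \<le> cmod (g y)"
  shows "ennreal (c * sqrt (2 * b)) \<le> L2_norm g"
proof -
  define I where "I = (\<integral>\<^sup>+ y. ennreal ((cmod (g y))\<^sup>2) \<partial>lborel)"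
  have "ennreal (c\<^sup>2 * (2 * b)) = (\<integral>\<^sup>+ y. ennreal (c\<^sup>2) * indicator {-b..b} y \<partial>lborel)"
    using assms(1,2) by (simp add: nn_integral_cmult_indicator ennreal_mult)
  also have "\<dots> \<le> I"
    unfolding I_def
  proof (rule nn_integral_mono)
    fix y
    show "ennreal (c\<^sup>2) * indicator {-b..b} y \<le> ennreal ((cmod (g y))\<^sup>2)"
      using assms(1) assms(3)[of y] by (auto simp: indicator_def power_mono)
  qed
  finally have I: "ennreal (c\<^sup>2 * (2 * b)) \<le> I" .
  show ?thesis
  proof (cases "I = \<infinity>")
    case True
    then show ?thesis by (simp add: L2_norm_def I_def[symmetric])
  next
    case False
    then obtain r where r: "0 \<le> r" "I = ennreal r" by (cases I) auto
    have "c * sqrt (2 * b) = sqrt (c\<^sup>2 * (2 * b))" using assms(1) by (simp add: real_sqrt_mult)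
    also have "\<dots> \<le> sqrt r" using I r by simp
    finally show ?thesis using r by (simp add: L2_norm_def I_def[symmetric])
  qed
qed

lemma vector_3_axis: "(vector [a, b, c] :: real ^ 3) = a *\<^sub>R axis 1 1 + b *\<^sub>R axis 2 1 + c *\<^sub>R axis 3 1"
  by (simp add: vec_eq_iff forall_3 axis_def)

lemma continuous_on_eval_real [continuous_intros]:
  assumes "continuous_on T f"
  shows "continuous_on T (\<lambda>x. eval_real p (f x))"
  unfolding eval_mvpoly_def by (intro continuous_intros assms)

text \<open>On the box the integrand differs from \<open>w\<close> by at most half its modulus, so
  the integral over the square is at least \<open>2 a\<^sup>2 * cmod w\<close>. Normalization
  divides this by \<open>2 a\<close>, and the \<open>y\<close>-interval of length \<open>2 b\<close>
  contributes \<open>sqrt (2 b)\<close>.\<close>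

lemma osc_operator_norm_ge:
  assumes "0 < a" "0 \<le> b" and \<Phi>: "continuous_on UNIV \<Phi>"
    and close: "\<And>(x :: real ^ 2) y. \<bar>x $ 1\<bar> \<le> a \<Longrightarrow> \<bar>x $ 2\<bar> \<le> a \<Longrightarrow> \<bar>y\<bar> \<le> b \<Longrightarrow>
      cmod (exp (\<i> * of_real (lam * eval_real S (vector [x $ 1, x $ 2, y]))) *
        \<Phi> (vector [x $ 1, x $ 2, y]) - w) \<le> cmod w / 2"
  shows "ennreal (cmod w * a * sqrt (2 * b)) \<le> L2_operator_norm (osc_operator S \<Phi> lam)"
proof -
  define B where "B = (cbox (\<chi> i. - a) (\<chi> i. a) :: (real ^ 2) set)"
  define f where "f x = (indicator B x / of_real (2 * a) :: complex)" for x
  have "L2_norm f = 1"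
    using L2_norm_indicator_box[OF assms(1)] by (simp add: f_def[abs_def] B_def)
  moreover have "f \<in> borel_measurable lborel" by (simp add: f_def[abs_def] B_def)
  ultimately have norm_le: "L2_norm (osc_operator S \<Phi> lam f) \<le> L2_operator_norm (osc_operator S \<Phi> lam)"
    unfolding L2_operator_norm_def by (intro SUP_upper) auto
  have B: "measure lborel B = 4 * a\<^sup>2"
    using content_cbox_cart[of "\<chi> i. - a" "\<chi> i::2. a"] assms(1)
    by (auto simp: B_def prod_constant power2_eq_square interval_ne_empty_cart)
  have "cmod w * a \<le> cmod (osc_operator S \<Phi> lam f y)" if y: "\<bar>y\<bar> \<le> b" for y
  proof -
    define G where "G x = exp (\<i> * of_real (lam * eval_real S (vector [x $ 1, x $ 2, y]))) *
        \<Phi> (vector [x $ 1, x $ 2, y])" for x :: "real ^ 2"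
    have G_cont: "continuous_on UNIV G"
      unfolding G_def vector_3_axis
      by (intro continuous_intros continuous_on_compose2[OF \<Phi>]) auto
    have int: "integrable lborel (\<lambda>x. indicator B x *\<^sub>R g x)" if "continuous_on UNIV g" for g :: "real ^ 2 \<Rightarrow> complex"
      unfolding B_def using that
      by (intro borel_integrable_compact compact_cbox) (auto intro: continuous_on_subset)
    have intB: "integrable lborel (indicator B :: real ^ 2 \<Rightarrow> real)"
      using emeasure_lborel_cbox_finite[of "\<chi> i. - a" "\<chi> i::2. a"]
      by (simp add: B_def)
    have w_int: "(LINT x|lborel. indicator B x *\<^sub>R w) = of_real (4 * a\<^sup>2) * w"
      using B intB by (simp add: scaleR_conv_of_real)
    have "cmod ((LINT x|lborel. indicator B x *\<^sub>R G x) - of_real (4 * a\<^sup>2) * w) =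
        cmod (LINT x|lborel. indicator B x *\<^sub>R (G x - w))"
      unfolding w_int[symmetric]
      by (simp add: scaleR_diff_right Bochner_Integration.integral_diff int G_cont continuous_on_const)
    also have "\<dots> \<le> (LINT x|lborel. cmod (indicator B x *\<^sub>R (G x - w)))"
      by (rule integral_norm_bound)
    also have "\<dots> \<le> (LINT x|lborel. indicator B x *\<^sub>R (cmod w / 2))"
    proof (rule integral_mono)
      show "integrable lborel (\<lambda>x. cmod (indicator B x *\<^sub>R (G x - w)))"
        by (intro integrable_norm int continuous_intros G_cont)
      show "integrable lborel (\<lambda>x. indicator B x *\<^sub>R (cmod w / 2))"
        using intB by simp
      fix x
      have "cmod (G x - w) \<le> cmod w / 2" if "x \<in> B"
        using that y close[of x y] unfolding G_def B_def by (force simp: mem_box_cart forall_2)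
      then show "cmod (indicator B x *\<^sub>R (G x - w)) \<le> indicator B x *\<^sub>R (cmod w / 2)"
        by (simp add: indicator_def)
    qed
    also have "\<dots> = 2 * a\<^sup>2 * cmod w" using B intB by simp
    finally have "cmod ((LINT x|lborel. indicator B x *\<^sub>R G x) - of_real (4 * a\<^sup>2) * w) \<le> 2 * a\<^sup>2 * cmod w" .
    moreover have "cmod (of_real (4 * a\<^sup>2) * w) \<le> cmod (LINT x|lborel. indicator B x *\<^sub>R G x) +
        cmod ((LINT x|lborel. indicator B x *\<^sub>R G x) - of_real (4 * a\<^sup>2) * w)"
      by (subst norm_minus_commute) (rule norm_triangle_sub)
    moreover have "cmod (of_real (4 * a\<^sup>2) * w) = 4 * a\<^sup>2 * cmod w" by (simp add: norm_mult norm_power)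
    ultimately have L: "2 * a\<^sup>2 * cmod w \<le> cmod (LINT x|lborel. indicator B x *\<^sub>R G x)" by linarith
    have "osc_operator S \<Phi> lam f y = (LINT x|lborel. indicator B x *\<^sub>R G x) / of_real (2 * a)"
    proof -
      have "osc_operator S \<Phi> lam f y = (LINT x|lborel. (indicator B x *\<^sub>R G x) / of_real (2 * a))"
        unfolding osc_operator_def
        by (intro Bochner_Integration.integral_cong refl) (simp add: f_def G_def indicator_def)
      then show ?thesis by simp
    qed
    then have "cmod (osc_operator S \<Phi> lam f y) = cmod (LINT x|lborel. indicator B x *\<^sub>R G x) / (2 * a)"
      using assms(1) by (simp add: norm_divide norm_mult)
    moreover have "2 * a\<^sup>2 * cmod w / (2 * a) \<le> cmod (LINT x|lborel. indicator B x *\<^sub>R G x) / (2 * a)"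
      using L assms(1) by (intro divide_right_mono) auto
    moreover have "2 * a\<^sup>2 * cmod w / (2 * a) = cmod w * a"
      using assms(1) by (simp add: power2_eq_square)
    ultimately show ?thesis by simp
  qed
  then have "ennreal (cmod w * a * sqrt (2 * b)) \<le> L2_norm (osc_operator S \<Phi> lam f)"
    using assms by (intro L2_norm_ge_interval) auto
  then show ?thesis using norm_le by (rule order.trans)
qed

lemma amplitude_near_origin:
  fixes \<Phi> :: "real ^ 3 \<Rightarrow> complex"
  assumes "continuous_on UNIV \<Phi>" "\<Phi> 0 \<noteq> 0"
  obtains r where "r > 0" "\<And>z \<theta>. (\<And>i. \<bar>z $ i\<bar> \<le> r) \<Longrightarrow> \<bar>\<theta>\<bar> \<le> 1/5 \<Longrightarrow>
    cmod (exp (\<i> * of_real \<theta>) * \<Phi> z - \<Phi> 0) \<le> cmod (\<Phi> 0) / 2"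
proof -
  have "cmod (\<Phi> 0) / 4 > 0" using assms(2) by simp
  then obtain d where d: "d > 0" "\<And>z. dist z 0 < d \<Longrightarrow> dist (\<Phi> z) (\<Phi> 0) < cmod (\<Phi> 0) / 4"
    using assms(1) unfolding continuous_on_iff by (metis UNIV_I)
  show thesis
  proof
    \<comment> \<open>Three coordinates of size at most \<open>d / 4\<close> keep the norm below
      \<open>d\<close>.\<close>
    show "d / 4 > 0" using d by simp
    fix z :: "real ^ 3" and \<theta> :: real
    assume z: "\<And>i. \<bar>z $ i\<bar> \<le> d / 4" and \<theta>: "\<bar>\<theta>\<bar> \<le> 1/5"
    have "norm z \<le> 3 * (d / 4)"
      using norm_le_l1_cart[of z] z[of 1] z[of 2] z[of 3] by (simp add: sum_3)
    then have near: "cmod (\<Phi> z - \<Phi> 0) \<le> cmod (\<Phi> 0) / 4"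
      using d(1) d(2)[of z] by (simp add: dist_norm)
    have "cmod (\<Phi> z) \<le> cmod (\<Phi> 0) + cmod (\<Phi> z - \<Phi> 0)" by (metis norm_triangle_sub)
    with near have big: "cmod (\<Phi> z) \<le> 5/4 * cmod (\<Phi> 0)" by linarith
    \<comment> \<open>The left side is \<open>2 * \<bar>sin (\<theta> / 2)\<bar>\<close>. The bound
      \<open>1/5\<close> is matched to the factor \<open>5/4\<close> for the amplitude: their
      product is \<open>1/4\<close>, half of the permitted error.\<close>
    have "cmod (exp (\<i> * of_real \<theta>) - 1) \<le> 1/5"
      using abs_sin_x_le_abs_x[of "\<theta> / 2"] \<theta> by (simp add: dist_exp_i_1)
    then have "cmod (exp (\<i> * of_real \<theta>) - 1) * cmod (\<Phi> z) \<le> 1/5 * (5/4 * cmod (\<Phi> 0))"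
      using big by (intro mult_mono) auto
    then have small: "cmod ((exp (\<i> * of_real \<theta>) - 1) * \<Phi> z) \<le> cmod (\<Phi> 0) / 4"
      by (simp add: norm_mult)
    have "exp (\<i> * of_real \<theta>) * \<Phi> z - \<Phi> 0 =
        (exp (\<i> * of_real \<theta>) - 1) * \<Phi> z + (\<Phi> z - \<Phi> 0)" by (simp add: algebra_simps)
    also have "cmod \<dots> \<le> cmod (\<Phi> 0) / 4 + cmod (\<Phi> 0) / 4"
      using small near by (rule norm_triangle_mono)
    finally show "cmod (exp (\<i> * of_real \<theta>) * \<Phi> z - \<Phi> 0) \<le> cmod (\<Phi> 0) / 2" by simp
  qed
qed

lemma homogeneous_abs_le:
  fixes h :: "(real, 2) mvpoly"
  assumes "homogeneous m h" "\<bar>x $ 1\<bar> \<le> a" "\<bar>x $ 2\<bar> \<le> a"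
  shows "\<bar>eval_real h x\<bar> \<le> (\<Sum>\<beta>\<in>Poly_Mapping.keys h. \<bar>Poly_Mapping.lookup h \<beta>\<bar>) * a ^ m"
proof -
  have "\<bar>eval_real h x\<bar> \<le> (\<Sum>\<beta>\<in>Poly_Mapping.keys h. \<bar>Poly_Mapping.lookup h \<beta> * (\<Prod>i\<in>UNIV. x $ i ^ (\<beta> $ i))\<bar>)"
    unfolding eval_mvpoly_def by (rule sum_abs)
  also have "\<dots> \<le> (\<Sum>\<beta>\<in>Poly_Mapping.keys h. \<bar>Poly_Mapping.lookup h \<beta>\<bar> * a ^ m)"
  proof (rule sum_mono)
    fix \<beta> assume "\<beta> \<in> Poly_Mapping.keys h"
    then have "m = \<beta> $ 1 + \<beta> $ 2" using assms(1) by (auto simp: homogeneous_def sum_2)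
    moreover have "\<bar>x $ 1\<bar> ^ (\<beta> $ 1) * \<bar>x $ 2\<bar> ^ (\<beta> $ 2) \<le> a ^ (\<beta> $ 1) * a ^ (\<beta> $ 2)"
      using assms(2,3) by (intro mult_mono power_mono) auto
    ultimately show "\<bar>Poly_Mapping.lookup h \<beta> * (\<Prod>i\<in>UNIV. x $ i ^ (\<beta> $ i))\<bar> \<le> \<bar>Poly_Mapping.lookup h \<beta>\<bar> * a ^ m"
      by (simp add: UNIV_2 abs_mult power_abs power_add mult_left_mono)
  qed
  finally show ?thesis by (simp add: sum_distrib_right)
qed

section \<open>Choice of the box for the phase\<close>

context osc_phase
begin

text \<open>The inequality makes every term of the phase at most of order \<open>1 / lam\<close> on
  the box. It is an equality for all \<open>j\<close> in the first case, for \<open>j = s\<close> in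
  the second and for \<open>j = 1\<close> in the third.\<close>

lemma scaling_exponents:
  obtains p q :: real where "0 \<le> p" "0 \<le> q" "p + q / 2 = 1 / (2 * \<delta>)"
    "\<And>j. j \<in> {1..s} \<Longrightarrow> 1 \<le> p * real (n - N j) + q * real (N j)"
proof -
  consider "\<delta> = real n / 3" | "\<delta> = real (n - N s) / 2" | "\<delta> = real (N 1)"
    unfolding \<delta>_def max_def by metis
  then show thesis
  proof cases
    case 1
    show thesis
    proof (rule that[of "1 / n" "1 / n"])
      fix j assume "j \<in> {1..s}"
      then have "real (n - N j) + real (N j) = real n" using N_bounds(3) by fastforce
      then have "1 / real n * real (n - N j) + 1 / real n * real (N j) = 1"
        using N_chain by (simp flip: add_divide_distrib)
      then show "1 \<le> 1 / real n * real (n - N j) + 1 / real n * real (N j)" by simp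
    qed (simp_all add: 1)
  next
    case 2
    show thesis
    proof (rule that[of "1 / (n - N s)" 0])
      fix j assume "j \<in> {1..s}"
      then have "n - N s \<le> n - N j" using N_bounds(2) by (simp add: diff_le_mono2)
      then show "1 \<le> 1 / real (n - N s) * real (n - N j) + 0 * real (N j)"
        using N_chain by (simp add: field_simps)
    qed (simp_all add: 2)
  next
    case 3
    show thesis
    proof (rule that[of 0 "1 / N 1"])
      fix j assume "j \<in> {1..s}"
      then show "1 \<le> 0 * real (n - N j) + 1 / real (N 1) * real (N j)"
        using N_chain N_bounds(1) by (simp add: field_simps)
    qed (simp_all add: 3)
  qed
qed

text \<open>Here \<open>M\<close> is the sum of the absolute values of all coefficients of the
  forms. It depends on none of \<open>p\<close>, \<open>q\<close>, \<open>\<epsilon>\<close> and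
  \<open>lam\<close>, so \<open>\<epsilon>\<close> may be chosen after \<open>M\<close>.\<close>

lemma phase_bound_on_box:
  obtains M where "0 \<le> M"
    "\<And>p q \<epsilon> lam (x :: real ^ 2) y. 0 < \<epsilon> \<Longrightarrow> \<epsilon> \<le> 1 \<Longrightarrow> 1 \<le> lam \<Longrightarrow>
      (\<And>j. j \<in> {1..s} \<Longrightarrow> 1 \<le> p * real (n - N j) + q * real (N j)) \<Longrightarrow>
      \<bar>x $ 1\<bar> \<le> \<epsilon> * lam powr (- p) \<Longrightarrow> \<bar>x $ 2\<bar> \<le> \<epsilon> * lam powr (- p) \<Longrightarrow> \<bar>y\<bar> \<le> \<epsilon> * lam powr (- q) \<Longrightarrow>
      \<bar>lam * eval_real S (vector [x $ 1, x $ 2, y])\<bar> \<le> \<epsilon> * M"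
proof
  let ?H = "\<lambda>j. \<Sum>\<beta>\<in>Poly_Mapping.keys (h (n - N j)). \<bar>Poly_Mapping.lookup (h (n - N j)) \<beta>\<bar>"
  show "0 \<le> (\<Sum>j=1..s. ?H j)" by (intro sum_nonneg) auto
  fix p q \<epsilon> lam :: real and x :: "real ^ 2" and y
  assume \<epsilon>: "0 < \<epsilon>" "\<epsilon> \<le> 1" and lam: "1 \<le> lam"
    and pq: "\<And>j. j \<in> {1..s} \<Longrightarrow> 1 \<le> p * real (n - N j) + q * real (N j)"
    and x: "\<bar>x $ 1\<bar> \<le> \<epsilon> * lam powr (- p)" "\<bar>x $ 2\<bar> \<le> \<epsilon> * lam powr (- p)" and y: "\<bar>y\<bar> \<le> \<epsilon> * lam powr (- q)"
  have term_le: "\<bar>y ^ N j * eval_real (h (n - N j)) x\<bar> \<le> ?H j * (\<epsilon> * lam powr (- 1))" if j: "j \<in> {1..s}" for j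
  proof -
    have "\<bar>y ^ N j * eval_real (h (n - N j)) x\<bar> \<le>
        (\<epsilon> * lam powr (- q)) ^ N j * (?H j * (\<epsilon> * lam powr (- p)) ^ (n - N j))"
      unfolding abs_mult power_abs
      using x y \<epsilon> by (intro mult_mono power_mono homogeneous_abs_le hom j) (auto intro!: sum_nonneg)
    also have "\<dots> = ?H j * (\<epsilon> ^ (N j + (n - N j)) * lam powr (- (p * real (n - N j) + q * real (N j))))"
      using lam by (simp add: power_mult_distrib power_add powr_power powr_add powr_diff powr_minus field_simps)
    also have "\<dots> \<le> ?H j * (\<epsilon> * lam powr (- 1))"
    proof (intro mult_left_mono mult_mono)
      \<comment> \<open>The exponent is \<open>n\<close>; one power of \<open>\<epsilon>\<close> is
        enough to make the phase small.\<close>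
      have "N j + (n - N j) \<ge> 1" using N_bounds(3)[OF j] by simp
      then show "\<epsilon> ^ (N j + (n - N j)) \<le> \<epsilon>"
        using \<epsilon> power_decreasing[of 1 "N j + (n - N j)" \<epsilon>] by simp
      show "lam powr (- (p * real (n - N j) + q * real (N j))) \<le> lam powr (- 1)"
        using pq[OF j] lam by (intro powr_mono) auto
    qed (use \<epsilon> in \<open>auto intro: sum_nonneg\<close>)
    finally show ?thesis .
  qed
  have "\<bar>eval_real S (vector [x $ 1, x $ 2, y])\<bar> \<le> (\<Sum>j=1..s. \<bar>y ^ N j * eval_real (h (n - N j)) x\<bar>)"
    unfolding eval_S by (rule sum_abs)
  also have "\<dots> \<le> (\<Sum>j=1..s. ?H j * (\<epsilon> * lam powr (- 1)))" by (intro sum_mono term_le)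
  also have "\<dots> = \<epsilon> * (\<Sum>j=1..s. ?H j) * lam powr (- 1)"
    unfolding sum_distrib_right[symmetric] by (simp only: mult_ac)
  finally have "lam * \<bar>eval_real S (vector [x $ 1, x $ 2, y])\<bar> \<le> lam * (\<epsilon> * (\<Sum>j=1..s. ?H j) * lam powr (- 1))"
    using lam by (intro mult_left_mono) auto
  also have "\<dots> = \<epsilon> * (\<Sum>j=1..s. ?H j)" using lam by (simp add: powr_minus field_simps)
  finally show "\<bar>lam * eval_real S (vector [x $ 1, x $ 2, y])\<bar> \<le> \<epsilon> * (\<Sum>j=1..s. ?H j)"
    using lam by (simp add: abs_mult)
qed

lemma operator_norm_lower_bound:
  assumes "continuous_on UNIV \<Phi>" "\<Phi> 0 \<noteq> 0"
  obtains C where "C > 0"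
    "\<And>lam. 1 \<le> lam \<Longrightarrow> ennreal (C * lam powr (- (1 / (2 * \<delta>)))) \<le> L2_operator_norm (osc_operator S \<Phi> lam)"
proof -
  obtain r where r: "r > 0" "\<And>z \<theta>. (\<And>i. \<bar>z $ i\<bar> \<le> r) \<Longrightarrow> \<bar>\<theta>\<bar> \<le> 1/5 \<Longrightarrow>
      cmod (exp (\<i> * of_real \<theta>) * \<Phi> z - \<Phi> 0) \<le> cmod (\<Phi> 0) / 2"
    using amplitude_near_origin[OF assms] by metis
  obtain p q where pq: "0 \<le> p" "0 \<le> q" "p + q / 2 = 1 / (2 * \<delta>)"
    "\<And>j. j \<in> {1..s} \<Longrightarrow> 1 \<le> p * real (n - N j) + q * real (N j)"
    using scaling_exponents by metis
  obtain M where M: "0 \<le> M"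
    "\<And>\<epsilon> lam (x :: real ^ 2) y. 0 < \<epsilon> \<Longrightarrow> \<epsilon> \<le> 1 \<Longrightarrow> 1 \<le> lam \<Longrightarrow>
      \<bar>x $ 1\<bar> \<le> \<epsilon> * lam powr (- p) \<Longrightarrow> \<bar>x $ 2\<bar> \<le> \<epsilon> * lam powr (- p) \<Longrightarrow> \<bar>y\<bar> \<le> \<epsilon> * lam powr (- q) \<Longrightarrow>
      \<bar>lam * eval_real S (vector [x $ 1, x $ 2, y])\<bar> \<le> \<epsilon> * M"
    using phase_bound_on_box pq(4) by metis
  \<comment> \<open>The bound by \<open>r\<close> keeps the box where the amplitude is nearly
    constant, the last one keeps the phase below \<open>1/5\<close>; \<open>M + 1\<close> avoids
    division by zero.\<close>
  define \<epsilon> where "\<epsilon> = min (min 1 r) (1 / (5 * (M + 1)))"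
  have \<epsilon>: "0 < \<epsilon>" "\<epsilon> \<le> 1" "\<epsilon> \<le> r" using r(1) M(1) by (auto simp: \<epsilon>_def)
  have "\<epsilon> * M \<le> 1 / (5 * (M + 1)) * M"
    using M(1) by (intro mult_right_mono) (auto simp: \<epsilon>_def)
  also have "\<dots> \<le> 1/5" using M(1) by (simp add: field_simps)
  finally have \<epsilon>M: "\<epsilon> * M \<le> 1/5" .
  show thesis
  proof
    show "cmod (\<Phi> 0) * \<epsilon> * sqrt (2 * \<epsilon>) > 0" using \<epsilon>(1) assms(2) by simp
    fix lam :: real assume lam: "1 \<le> lam"
    have le_r: "\<epsilon> * lam powr (- t) \<le> r" if "0 \<le> t" for t
    proof -
      have "lam powr (- t) \<le> 1" using powr_mono[of "- t" 0 lam] lam that by simp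
      then have "\<epsilon> * lam powr (- t) \<le> \<epsilon>" using \<epsilon>(1) by (simp add: mult_left_le)
      then show ?thesis using \<epsilon>(3) by simp
    qed
    have "ennreal (cmod (\<Phi> 0) * (\<epsilon> * lam powr (- p)) * sqrt (2 * (\<epsilon> * lam powr (- q)))) \<le>
        L2_operator_norm (osc_operator S \<Phi> lam)"
    proof (rule osc_operator_norm_ge[OF _ _ assms(1)])
      fix x :: "real ^ 2" and y
      assume x: "\<bar>x $ 1\<bar> \<le> \<epsilon> * lam powr (- p)" "\<bar>x $ 2\<bar> \<le> \<epsilon> * lam powr (- p)" and y: "\<bar>y\<bar> \<le> \<epsilon> * lam powr (- q)"
      have "\<forall>i. \<bar>(vector [x $ 1, x $ 2, y] :: real ^ 3) $ i\<bar> \<le> r"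
        using x y le_r[OF pq(1)] le_r[OF pq(2)] by (simp add: forall_3)
      moreover have "\<bar>lam * eval_real S (vector [x $ 1, x $ 2, y])\<bar> \<le> 1/5"
        using M(2)[OF \<epsilon>(1,2) lam x y] \<epsilon>M by linarith
      ultimately show "cmod (exp (\<i> * of_real (lam * eval_real S (vector [x $ 1, x $ 2, y]))) *
        \<Phi> (vector [x $ 1, x $ 2, y]) - \<Phi> 0) \<le> cmod (\<Phi> 0) / 2"
        by (intro r(2)) auto
    qed (use \<epsilon>(1) lam in auto)
    \<comment> \<open>The \<open>y\<close>-side enters the bound through a square root, hence the
      weight one half on \<open>q\<close>.\<close>
    moreover have "lam powr (- (1 / (2 * \<delta>))) = lam powr (- p) * sqrt (lam powr (- q))"
    proof -
      have "sqrt (lam powr (- q)) = lam powr (- (q / 2))"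
        using lam by (simp add: powr_half_sqrt[symmetric] powr_powr)
      then show ?thesis unfolding pq(3)[symmetric] by (simp add: powr_add[symmetric])
    qed
    ultimately show "ennreal (cmod (\<Phi> 0) * \<epsilon> * sqrt (2 * \<epsilon>) * lam powr (- (1 / (2 * \<delta>)))) \<le>
        L2_operator_norm (osc_operator S \<Phi> lam)"
      by (simp add: real_sqrt_mult mult_ac)
  qed
qed

end

text \<open>Both bounds together would give \<open>C \<le> D * lam powr (- (b - a))\<close> for
  large \<open>lam\<close>, and the right side tends to zero.\<close>

lemma powr_decay_not_improvable:
  fixes F :: "real \<Rightarrow> ennreal"
  assumes "C > 0" "\<forall>\<^sub>F lam in at_top. ennreal (C * lam powr (- a)) \<le> F lam" "a < b"
  shows "\<not> (\<forall>\<^sub>F lam in at_top. F lam \<le> ennreal (D * lam powr (- b)))"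
proof
  assume "\<forall>\<^sub>F lam in at_top. F lam \<le> ennreal (D * lam powr (- b))"
  with assms(2) have "\<forall>\<^sub>F lam in at_top. C \<le> D * lam powr (- (b - a))"
    using eventually_gt_at_top[of 0]
  proof eventually_elim
    case (elim lam)
    have "0 < C * lam powr (- a)" using assms(1) elim by simp
    moreover have "ennreal (C * lam powr (- a)) \<le> ennreal (D * lam powr (- b))" using elim by order
    \<comment> \<open>Since \<open>ennreal\<close> sends negative numbers to zero, positivity of the
      left side is what allows the return to the reals for arbitrary \<open>D\<close>.\<close>
    ultimately have "C * lam powr (- a) \<le> D * lam powr (- b)" by (auto simp: ennreal_le_iff2)
    then have "C * lam powr (- a) * lam powr a \<le> D * lam powr (- b) * lam powr a"
      by (intro mult_right_mono) auto
    then show ?case using elim by (simp add: mult.assoc flip: powr_add)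
  qed
  moreover have "((\<lambda>lam. D * lam powr (- (b - a))) \<longlongrightarrow> D * 0) at_top"
    using assms(3) by (intro tendsto_intros tendsto_neg_powr filterlim_ident) auto
  ultimately have "C \<le> D * 0"
    by (intro tendsto_lowerbound[of "\<lambda>lam. D * lam powr (- (b - a))"]) auto
  then show False using assms(1) by simp
qed

theorem theorem2:
  fixes s n :: nat
    and N :: "nat \<Rightarrow> nat"
    and h :: "nat \<Rightarrow> (real, 2) mvpoly"
    and S :: "(real, 3) mvpoly"
    and \<delta> :: real
    and \<Phi> :: "real ^ 3 \<Rightarrow> complex"
  assumes "s \<ge> 1"
    and "0 < N 1" and "strict_mono_on {1..s} N" and "N s < n"
    and "\<And>j. j \<in> {1..s} \<Longrightarrow> homogeneous (n - N j) (h (n - N j))"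
    and "nondegenerate (h (n - N 1))" and "nondegenerate (h (n - N s))"
    and "S = (\<Sum>j=1..s. Var 3 ^ N j * eval_mvpoly Const (h (n - N j)) (vector [Var 1, Var 2]))"
    and "\<delta> = max (max (real n / 3) (real (n - N s) / 2)) (real (N 1))"
    and "smooth_compactly_supported \<Phi>"
  shows "(\<Phi> 0 \<noteq> 0 \<longrightarrow>
            (\<exists>C>0. \<forall>\<^sub>F lam in at_top.
               L2_operator_norm (osc_operator S \<Phi> lam) \<ge> ennreal (C * lam powr (- (1 / (2 * \<delta>))))) \<and>
            (\<forall>\<epsilon> > 1 / (2 * \<delta>). \<not> (\<exists>C. \<forall>\<^sub>F lam in at_top.
               L2_operator_norm (osc_operator S \<Phi> lam) \<le> ennreal (C * lam powr (- \<epsilon>)))))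
         \<and> is_modified_newton_distance S \<delta>"
proof -
  interpret phase: osc_phase s n N h S
    using assms(1-8) by unfold_locales
  have \<delta>: "\<delta> = phase.\<delta>" by (simp add: assms(9) phase.\<delta>_def)
  have "C_k 0 \<Phi>" using assms(10) unfolding smooth_compactly_supported_def by blast
  then have cont: "continuous_on UNIV \<Phi>" by simp
  show ?thesis
  proof (intro conjI impI allI)
    assume "\<Phi> 0 \<noteq> 0"
    then obtain C where "C > 0" and C: "\<And>lam. 1 \<le> lam \<Longrightarrow>
        ennreal (C * lam powr (- (1 / (2 * \<delta>)))) \<le> L2_operator_norm (osc_operator S \<Phi> lam)"
      using phase.operator_norm_lower_bound[OF cont] unfolding \<delta> by metis
    have lower: "\<forall>\<^sub>F lam in at_top.
        ennreal (C * lam powr (- (1 / (2 * \<delta>)))) \<le> L2_operator_norm (osc_operator S \<Phi> lam)"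
      using eventually_ge_at_top[of 1] by eventually_elim (rule C)
    with \<open>C > 0\<close> show "\<exists>C>0. \<forall>\<^sub>F lam in at_top.
        ennreal (C * lam powr (- (1 / (2 * \<delta>)))) \<le> L2_operator_norm (osc_operator S \<Phi> lam)" by blast
    show "\<not> (\<exists>D. \<forall>\<^sub>F lam in at_top.
        L2_operator_norm (osc_operator S \<Phi> lam) \<le> ennreal (D * lam powr (- \<epsilon>)))"
      if "1 / (2 * \<delta>) < \<epsilon>" for \<epsilon>
      using powr_decay_not_improvable[OF \<open>C > 0\<close> lower that] by simp
  next
    show "is_modified_newton_distance S \<delta>"
      unfolding \<delta> by (rule phase.modified_newton_distance_S)
  qed
qed

end
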